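(* Let $I$ be an interval, $t_0\in I$, $F\in C^\infty(I,(0,\infty))$ and $\kappa\in\mathbb R$. Set $T=\kappa/F^2$, define $\tau(t)=\int_{t_0}^tF(\xi)^{-1}\,d\xi$, and let $(\ell_1,\ell_2)$ be the unique pair of positive functions on $I$ with $\ell_1^{k_1}\ell_2^{k_2}=F$ and $d_2/\ell_2^2-d_1/\ell_1^2=T$. For a smooth curve $\gamma:I\to\mathbb S^3$, the product $G_\gamma$ is harmonic for $g_{F,\kappa}=dt^2+\ell_1^2g_1+\ell_2^2g_2$ if and only if $\gamma=\Gamma\circ\tau$, where $\Gamma:\tau(I)\to\mathbb S^3$ solves the Neumann equation $$\nabla_\tau^{\mathbb S^3}\dot\Gamma=\kappa\,\mathrm{grad}_{\mathbb S^3}U(\Gamma),\qquad U(z_1,z_2)=|z_2|^2/2,$$ with mechanical potential $-\kappa U$.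
   Context: Setting. For $i=1,2$, $(M_i,g_i)$ is a Riemannian manifold of dimension $k_i>0$, and $f_i:(M_i,g_i)\to\mathbb S^{2n_i+1}\subset\mathbb C^{n_i+1}$ (unit round sphere) is an eigenmap: a smooth map with $\Delta f_i=-d_if_i$, $d_i=|df_i|^2>0$ constant. A map $f$ into a unit sphere is harmonic iff $\Delta f=-|df|^2f$. For a smooth curve $\gamma=(z_1,z_2):I\to\mathbb S^3\subset\mathbb C^2$, $G_\gamma(t,x,y)=(z_1(t)f_1(x),z_2(t)f_2(y))$ maps $I\times M_1\times M_2$ to $\mathbb S^{2n_1+2n_2+3}$. For $F>0$, $T\in\mathbb R$ the positive pair $(\ell_1,\ell_2)$ with $\ell_1^{k_1}\ell_2^{k_2}=F$ and $d_2/\ell_2^2-d_1/\ell_1^2=T$ exists, is unique, and depends smoothly on $(F,T)$. $\nabla^{\mathbb S^3}$ and $\mathrm{grad}_{\mathbb S^3}$ are those of the round metric; the dot is $d/d\tau$. *)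

theory Defs
  imports "HOL-Analysis.Analysis"
begin

section \<open>Smooth maps on subsets of Euclidean space\<close>

text \<open>
  All derivatives are Frechet derivatives \<^emph>\<open>within\<close> the given set \<open>S\<close>.  They agree with the usual
  ones when \<open>S\<close> is open, and they are one-sided at the end points of an interval, or at the
  boundary points of a product of an interval with an open set.  The notions below are used only
  for such \<open>S\<close>, where the derivative within \<open>S\<close> is unique.
\<close>

definition ddir :: "'e::real_normed_vector set \<Rightarrow> ('e \<Rightarrow> 'f::real_normed_vector) \<Rightarrow> 'e \<Rightarrow> 'e \<Rightarrow> 'f" where
  "ddir S f v x = frechet_derivative f (at x within S) v"

fun Ck_on :: "nat \<Rightarrow> 'e::real_normed_vector set \<Rightarrow> ('e \<Rightarrow> 'f::real_normed_vector) \<Rightarrow> bool" where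
  "Ck_on 0 S f \<longleftrightarrow> continuous_on S f"
| "Ck_on (Suc k) S f \<longleftrightarrow> f differentiable_on S \<and> (\<forall>v. Ck_on k S (ddir S f v))"

definition smooth_on :: "'e::real_normed_vector set \<Rightarrow> ('e \<Rightarrow> 'f::real_normed_vector) \<Rightarrow> bool" where
  "smooth_on S f \<longleftrightarrow> (\<forall>k. Ck_on k S f)"

section \<open>Riemannian geometry in a coordinate domain\<close>

text \<open>
  A metric on a coordinate domain \<open>S\<close> is a function \<open>g\<close> with \<open>g x u v\<close> the inner product of the
  coordinate vectors \<open>u\<close> and \<open>v\<close> at \<open>x\<close>.  For an inner product \<open>b\<close>, the vector \<open>sharp b w\<close> is the
  unique \<open>u\<close> such that \<open>b u v = w \<bullet> v\<close> for all \<open>v\<close>, so that \<open>ginv b\<close> is the inverse of the matrix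
  of \<open>b\<close> with respect to \<open>Basis\<close>.
\<close>

type_synonym 'e metric = "'e \<Rightarrow> 'e \<Rightarrow> 'e \<Rightarrow> real"

definition sharp :: "('e::euclidean_space \<Rightarrow> 'e \<Rightarrow> real) \<Rightarrow> 'e \<Rightarrow> 'e" where
  "sharp b = inv (\<lambda>u. \<Sum>j\<in>Basis. b u j *\<^sub>R j)"

definition ginv :: "('e::euclidean_space \<Rightarrow> 'e \<Rightarrow> real) \<Rightarrow> 'e \<Rightarrow> 'e \<Rightarrow> real" where
  "ginv b i j = i \<bullet> sharp b j"

definition gtrace :: "('e::euclidean_space \<Rightarrow> 'e \<Rightarrow> real) \<Rightarrow> ('e \<Rightarrow> 'e \<Rightarrow> 'f::real_vector) \<Rightarrow> 'f" where
  "gtrace b H = (\<Sum>i\<in>Basis. \<Sum>j\<in>Basis. ginv b i j *\<^sub>R H i j)"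

text \<open>Levi-Civita connection on constant coordinate vector fields, by the Koszul formula.\<close>

definition christoffel :: "'e::euclidean_space set \<Rightarrow> 'e metric \<Rightarrow> 'e \<Rightarrow> 'e \<Rightarrow> 'e \<Rightarrow> 'e" where
  "christoffel S g x u v = sharp (g x) (\<Sum>l\<in>Basis.
     ((ddir S (\<lambda>y. g y v l) u x + ddir S (\<lambda>y. g y u l) v x - ddir S (\<lambda>y. g y u v) l x) / 2) *\<^sub>R l)"

definition coord_laplacian ::
    "'e::euclidean_space set \<Rightarrow> 'e metric \<Rightarrow> ('e \<Rightarrow> 'f::real_normed_vector) \<Rightarrow> 'e \<Rightarrow> 'f" where
  "coord_laplacian S g f x =
     gtrace (g x) (\<lambda>u v. ddir S (ddir S f v) u x - ddir S f (christoffel S g x u v) x)"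

definition coord_energy_density ::
    "'e::euclidean_space set \<Rightarrow> 'e metric \<Rightarrow> ('e \<Rightarrow> 'f::real_inner) \<Rightarrow> 'e \<Rightarrow> real" where
  "coord_energy_density S g f x = gtrace (g x) (\<lambda>u v. ddir S f u x \<bullet> ddir S f v x)"

section \<open>The round unit sphere\<close>

text \<open>
  \<open>sphere_proj p\<close> is the orthogonal projection onto the tangent space of \<open>sphere 0 1\<close> at \<open>p\<close>; the
  Levi-Civita connection of the round metric is the flat one followed by this projection.
\<close>

definition sphere_proj :: "'a::real_inner \<Rightarrow> 'a \<Rightarrow> 'a" where
  "sphere_proj p v = v - (v \<bullet> p) *\<^sub>R p"

definition sphere_cov_deriv ::
    "real set \<Rightarrow> (real \<Rightarrow> 'a::real_inner) \<Rightarrow> (real \<Rightarrow> 'a) \<Rightarrow> real \<Rightarrow> 'a" where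
  "sphere_cov_deriv J c W s = sphere_proj (c s) (vector_derivative W (at s within J))"

definition velocity :: "real set \<Rightarrow> (real \<Rightarrow> 'a::real_normed_vector) \<Rightarrow> real \<Rightarrow> 'a" where
  "velocity J c s = vector_derivative c (at s within J)"

text \<open>
  The gradient in the round metric of the restriction of \<open>U\<close> to the unit sphere, for \<open>U\<close>
  differentiable on the ambient space.
\<close>

definition sphere_grad :: "('a::real_inner \<Rightarrow> real) \<Rightarrow> 'a \<Rightarrow> 'a" where
  "sphere_grad U p = (THE w. w \<bullet> p = 0 \<and>
     (\<forall>v. v \<bullet> p = 0 \<longrightarrow> w \<bullet> v = frechet_derivative U (at p) v))"

text \<open>
  The tension field of a map into the unit sphere is the trace of the second fundamental form
  \<open>\<nabla>df\<close>, where the sphere contributes its connection along \<open>f\<close> and the domain contributes the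
  Christoffel term.
\<close>

definition coord_tension ::
    "'e::euclidean_space set \<Rightarrow> 'e metric \<Rightarrow> ('e \<Rightarrow> 'f::real_inner) \<Rightarrow> 'e \<Rightarrow> 'f" where
  "coord_tension S g f x =
     gtrace (g x) (\<lambda>u v. sphere_proj (f x) (ddir S (ddir S f v) u x)
                          - ddir S f (christoffel S g x u v) x)"

section \<open>Riemannian manifolds\<close>

text \<open>
  A manifold is given by a topology and an indexed atlas, the metric by its components in each
  chart.  The dimension is \<open>DIM('e)\<close>, which is positive.
\<close>

record ('i, 'm, 'e) rmfd =
  topo :: "'m topology"
  charts :: "'i set"
  cdom :: "'i \<Rightarrow> 'm set"
  coord :: "'i \<Rightarrow> 'm \<Rightarrow> 'e"
  met :: "'i \<Rightarrow> 'e metric"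

definition cimg :: "('i, 'm, 'e) rmfd \<Rightarrow> 'i \<Rightarrow> 'e set" where
  "cimg M i = coord M i ` cdom M i"

definition cinv :: "('i, 'm, 'e) rmfd \<Rightarrow> 'i \<Rightarrow> 'e \<Rightarrow> 'm" where
  "cinv M i = inv_into (cdom M i) (coord M i)"

definition transition :: "('i, 'm, 'e) rmfd \<Rightarrow> 'i \<Rightarrow> 'i \<Rightarrow> 'e \<Rightarrow> 'e" where
  "transition M i j = coord M j \<circ> cinv M i"

text \<open>
  Manifolds are nonempty and without boundary; connectedness and completeness are not required.
\<close>

definition riemannian_manifold :: "('i, 'm, 'e::euclidean_space) rmfd \<Rightarrow> bool" where
  "riemannian_manifold M \<longleftrightarrow>
     topspace (topo M) \<noteq> {} \<and> Hausdorff_space (topo M) \<and> second_countable (topo M) \<and>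
     (\<Union>i\<in>charts M. cdom M i) = topspace (topo M) \<and>
     (\<forall>i\<in>charts M. openin (topo M) (cdom M i) \<and> open (cimg M i) \<and>
        homeomorphic_map (subtopology (topo M) (cdom M i)) (top_of_set (cimg M i)) (coord M i)) \<and>
     (\<forall>i\<in>charts M. \<forall>j\<in>charts M.
        smooth_on (coord M i ` (cdom M i \<inter> cdom M j)) (transition M i j)) \<and>
     (\<forall>i\<in>charts M. \<forall>x\<in>cimg M i. bilinear (met M i x) \<and>
        (\<forall>u v. met M i x u v = met M i x v u) \<and> (\<forall>u. u \<noteq> 0 \<longrightarrow> met M i x u u > 0)) \<and>
     (\<forall>i\<in>charts M. \<forall>u v. smooth_on (cimg M i) (\<lambda>x. met M i x u v)) \<and>
     (\<forall>i\<in>charts M. \<forall>j\<in>charts M. \<forall>x\<in>coord M i ` (cdom M i \<inter> cdom M j). \<forall>u v.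
        met M i x u v =
        met M j (transition M i j x)
          (frechet_derivative (transition M i j) (at x) u)
          (frechet_derivative (transition M i j) (at x) v))"

definition smooth_map :: "('i, 'm, 'e::euclidean_space) rmfd \<Rightarrow> ('m \<Rightarrow> 'f::real_normed_vector) \<Rightarrow> bool" where
  "smooth_map M f \<longleftrightarrow> (\<forall>i\<in>charts M. smooth_on (cimg M i) (f \<circ> cinv M i))"

text \<open>The Laplacian is the trace of the Hessian, so its spectrum is nonpositive.\<close>

definition laplacian_at ::
    "('i, 'm, 'e::euclidean_space) rmfd \<Rightarrow> 'i \<Rightarrow> ('m \<Rightarrow> 'f::real_normed_vector) \<Rightarrow> 'm \<Rightarrow> 'f" where
  "laplacian_at M i f p = coord_laplacian (cimg M i) (met M i) (f \<circ> cinv M i) (coord M i p)"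

definition energy_density_at ::
    "('i, 'm, 'e::euclidean_space) rmfd \<Rightarrow> 'i \<Rightarrow> ('m \<Rightarrow> 'f::real_inner) \<Rightarrow> 'm \<Rightarrow> real" where
  "energy_density_at M i f p = coord_energy_density (cimg M i) (met M i) (f \<circ> cinv M i) (coord M i p)"

definition tension_at ::
    "('i, 'm, 'e::euclidean_space) rmfd \<Rightarrow> 'i \<Rightarrow> ('m \<Rightarrow> 'f::real_inner) \<Rightarrow> 'm \<Rightarrow> 'f" where
  "tension_at M i f p = coord_tension (cimg M i) (met M i) (f \<circ> cinv M i) (coord M i p)"

definition eigenmap :: "('i, 'm, 'e::euclidean_space) rmfd \<Rightarrow> ('m \<Rightarrow> 'f::real_inner) \<Rightarrow> real \<Rightarrow> bool" where
  "eigenmap M f d \<longleftrightarrow> d > 0 \<and> smooth_map M f \<and> f ` topspace (topo M) \<subseteq> sphere 0 1 \<and>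
     (\<forall>i\<in>charts M. \<forall>p\<in>cdom M i.
        laplacian_at M i f p = - (d *\<^sub>R f p) \<and> energy_density_at M i f p = d)"

definition harmonic_into_sphere ::
    "('i, 'm, 'e::euclidean_space) rmfd \<Rightarrow> ('m \<Rightarrow> 'f::real_inner) \<Rightarrow> bool" where
  "harmonic_into_sphere M f \<longleftrightarrow> smooth_map M f \<and> f ` topspace (topo M) \<subseteq> sphere 0 1 \<and>
     (\<forall>i\<in>charts M. \<forall>p\<in>cdom M i. tension_at M i f p = 0)"

section \<open>Doubly warped products and product maps\<close>

text \<open>
  \<open>I \<times> M\<^sub>1 \<times> M\<^sub>2\<close> with the metric \<open>dt\<^sup>2 + \<ell>\<^sub>1\<^sup>2 g\<^sub>1 + \<ell>\<^sub>2\<^sup>2 g\<^sub>2\<close> and the product charts.  It has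
  boundary when \<open>I\<close> contains an end point.
\<close>

definition warped_product ::
    "real set \<Rightarrow> (real \<Rightarrow> real) \<Rightarrow> (real \<Rightarrow> real) \<Rightarrow>
     ('i1, 'm1, 'e1::euclidean_space) rmfd \<Rightarrow> ('i2, 'm2, 'e2::euclidean_space) rmfd \<Rightarrow>
     ('i1 \<times> 'i2, real \<times> 'm1 \<times> 'm2, real \<times> 'e1 \<times> 'e2) rmfd" where
  "warped_product I l1 l2 M1 M2 = \<lparr>
     topo = prod_topology (top_of_set I) (prod_topology (topo M1) (topo M2)),
     charts = charts M1 \<times> charts M2,
     cdom = (\<lambda>(i, j). I \<times> cdom M1 i \<times> cdom M2 j),
     coord = (\<lambda>(i, j) (t, p, q). (t, coord M1 i p, coord M2 j q)),
     met = (\<lambda>(i, j) (t, x, y) (r, u, v) (r', u', v').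
       r * r' + (l1 t)\<^sup>2 * met M1 i x u u' + (l2 t)\<^sup>2 * met M2 j y v v')\<rparr>"

definition product_map ::
    "(real \<Rightarrow> complex \<times> complex) \<Rightarrow> ('m1 \<Rightarrow> (complex^'n1)) \<Rightarrow> ('m2 \<Rightarrow> complex^'n2) \<Rightarrow>
     real \<times> 'm1 \<times> 'm2 \<Rightarrow> (complex^'n1) \<times> (complex^'n2)" where
  "product_map c f1 f2 = (\<lambda>(t, p, q). (fst (c t) *s f1 p, snd (c t) *s f2 q))"

section \<open>The Neumann equation\<close>

definition neumann_U :: "complex \<times> complex \<Rightarrow> real" where
  "neumann_U z = (cmod (snd z))\<^sup>2 / 2"

definition neumann_solution :: "real \<Rightarrow> real set \<Rightarrow> (real \<Rightarrow> complex \<times> complex) \<Rightarrow> bool" where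
  "neumann_solution \<kappa> J \<Gamma> \<longleftrightarrow> smooth_on J \<Gamma> \<and> \<Gamma> ` J \<subseteq> sphere 0 1 \<and>
     (\<forall>s\<in>J. sphere_cov_deriv J \<Gamma> (velocity J \<Gamma>) s = \<kappa> *\<^sub>R sphere_grad neumann_U (\<Gamma> s))"

lemma sphere_proj_scaleR: "sphere_proj p (c *\<^sub>R v) = c *\<^sub>R sphere_proj p v"
  by (simp add: sphere_proj_def scaleR_diff_right)

lemma sphere_proj_minus: "sphere_proj p (- v) = - sphere_proj p v"
  by (simp add: sphere_proj_def)

lemma neumann_U_has_derivative:
  "(neumann_U has_derivative (\<lambda>v. (0, snd p) \<bullet> v)) (at p)"
proof -
  have eq: "neumann_U = (\<lambda>z. (snd z \<bullet> snd z) / 2)"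
    by (simp add: neumann_U_def fun_eq_iff power2_norm_eq_inner)
  show ?thesis unfolding eq
    by (rule derivative_eq_intros refl | simp add: inner_commute inner_Pair_0 fun_eq_iff)+
qed

lemma sphere_grad_eq:
  fixes U :: "'a::real_inner \<Rightarrow> real"
  assumes p: "norm p = 1" and U: "(U has_derivative (\<lambda>v. w \<bullet> v)) (at p)"
  shows "sphere_grad U p = sphere_proj p w"
proof -
  have pp: "p \<bullet> p = 1" using p by (simp add: dot_square_norm)
  have fd: "frechet_derivative U (at p) = (\<lambda>v. w \<bullet> v)"
    using frechet_derivative_at[OF U] by simp
  show ?thesis unfolding sphere_grad_def fd
  proof (rule the_equality)
    show "sphere_proj p w \<bullet> p = 0 \<and> (\<forall>v. v \<bullet> p = 0 \<longrightarrow> sphere_proj p w \<bullet> v = w \<bullet> v)"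
      using pp by (simp add: sphere_proj_def inner_diff_left) (metis inner_commute mult_zero_right)
  next
    fix u assume u: "u \<bullet> p = 0 \<and> (\<forall>v. v \<bullet> p = 0 \<longrightarrow> u \<bullet> v = w \<bullet> v)"
    let ?d = "u - sphere_proj p w"
    have d: "?d \<bullet> p = 0"
      using u by (simp add: sphere_proj_def inner_diff_left pp)
    then have "u \<bullet> ?d = w \<bullet> ?d" using u by blast
    then have "?d \<bullet> ?d = 0"
    proof -
      have "?d \<bullet> ?d = (u \<bullet> ?d - w \<bullet> ?d) + (w \<bullet> p) * (p \<bullet> ?d)"
        by (subst (1) inner_diff_left) (simp add: sphere_proj_def inner_diff_left)
      also have "p \<bullet> ?d = 0" using d by (metis inner_commute)
      finally show ?thesis using \<open>u \<bullet> ?d = w \<bullet> ?d\<close> by simp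
    qed
    then show "u = sphere_proj p w" by simp
  qed
qed

text \<open>Neumann's equation is Newton's equation for the mechanical potential \<open>- \<kappa> U\<close>.\<close>

lemma neumann_mechanical_potential:
  assumes "norm p = 1"
  shows "- sphere_grad (\<lambda>z. - \<kappa> * neumann_U z) p = \<kappa> *\<^sub>R sphere_grad neumann_U p"
proof -
  have "((\<lambda>z. - \<kappa> * neumann_U z) has_derivative (\<lambda>v. (- \<kappa> *\<^sub>R (0, snd p)) \<bullet> v)) (at p)"
    using has_derivative_mult_right[OF neumann_U_has_derivative, of "- \<kappa>" p]
    by (simp only: inner_scaleR_left)
  from sphere_grad_eq[OF assms this] sphere_grad_eq[OF assms neumann_U_has_derivative]
  show ?thesis
    by (simp only: sphere_proj_scaleR sphere_proj_minus scaleR_minus_left minus_minus)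
qed

end

theory Submission
  imports Defs
begin

text \<open>
  In product charts the metric is block diagonal, and the trace of its Christoffel symbols along
  the factors contributes \<open>(k\<^sub>1 \<ell>\<^sub>1' / \<ell>\<^sub>1 + k\<^sub>2 \<ell>\<^sub>2' / \<ell>\<^sub>2) \<gamma>' = (F' / F) \<gamma>'\<close> to the tension field, since
  \<open>\<ell>\<^sub>1 ^ k\<^sub>1 * \<ell>\<^sub>2 ^ k\<^sub>2 = F\<close>.  At a point \<open>(x, y)\<close> the map \<open>(a, b) \<mapsto> (a f\<^sub>1 x, b f\<^sub>2 y)\<close> is a linear isometry,
  and the eigenmap equations give the tension field as its value at the projection to the tangent
  space at \<open>\<gamma>\<close> of \<open>\<gamma>'' + (F' / F) \<gamma>' - (d\<^sub>1 / \<ell>\<^sub>1\<^sup>2 z\<^sub>1, d\<^sub>2 / \<ell>\<^sub>2\<^sup>2 z\<^sub>2)\<close>.  Modulo the normal vector \<open>\<gamma>\<close> the last term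
  is \<open>(0, T z\<^sub>2)\<close>.  As \<open>d/d\<tau> = F d/dt\<close>, multiplication by \<open>F\<^sup>2\<close> gives Neumann's equation.
\<close>

text \<open>\<open>I\<close> may contain end points, so a chart image
  \<open>I \<times> U1 \<times> U2\<close> need not be open. Derivatives are therefore taken within
  sets, and their uniqueness has to be carried along as \<open>thick\<close>. The warping functions
  are given only through their two equations; their derivatives come from the inverse function
  theorem, and first derivatives suffice because the connection involves no higher ones. The
  eigenmap equations control the full Laplacian of each factor, whereas the tension field projects
  the second derivatives and leaves the Christoffel term alone. The two fit together because first
  derivatives of a sphere-valued map are tangent, so the projection may be put in front of the
  Christoffel term as well. The choice T = \<kappa> / F^2 makes the coefficient of (0, z2) equal to
  the constant \<kappa> after multiplication by F^2. In the converse direction \<Gamma> is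
  prescribed only on the image of \<tau>, so the two equations are compared for every \<Gamma> with
  \<gamma> = \<Gamma> \<circ> \<tau>.\<close>

section \<open>Derivatives within thick sets\<close>


text \<open>At the points of a thick set the Frechet derivative within the set is unique.\<close>

definition thick :: "'a::euclidean_space set \<Rightarrow> bool" where
  "thick S \<longleftrightarrow> (\<forall>x\<in>S. \<forall>i\<in>Basis. \<forall>e>0. \<exists>d. 0 < \<bar>d\<bar> \<and> \<bar>d\<bar> < e \<and> x + d *\<^sub>R i \<in> S)"

lemma thick_open:
  assumes "open S"
  shows "thick S"
  unfolding thick_def
proof (intro ballI allI impI)
  fix x i :: 'a and e :: real
  assume x: "x \<in> S" and i: "i \<in> Basis" and e: "e > 0"
  obtain r where r: "r > 0" "ball x r \<subseteq> S"
    using assms x openE by blast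
  have "x + (min e r / 2) *\<^sub>R i \<in> ball x r"
    using r e i by (simp add: dist_norm)
  then have "0 < \<bar>min e r / 2\<bar> \<and> \<bar>min e r / 2\<bar> < e \<and> x + (min e r / 2) *\<^sub>R i \<in> S"
    using r e by auto
  then show "\<exists>d. 0 < \<bar>d\<bar> \<and> \<bar>d\<bar> < e \<and> x + d *\<^sub>R i \<in> S"
    by blast
qed

lemma thick_interval:
  fixes I :: "real set"
  assumes "is_interval I" "a \<in> I" "b \<in> I" "a < b"
  shows "thick I"
  unfolding thick_def
proof (intro ballI allI impI)
  fix x i :: real and e :: real
  assume x: "x \<in> I" and i: "i \<in> Basis" and e: "e > 0"
  obtain y where y: "y \<in> I" "y \<noteq> x"
    using assms by (cases "x = a") auto
  \<comment> \<open>A step from \<open>x\<close> towards the second point \<open>y\<close>,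
    shortened so that it stays below \<open>e\<close> and does not pass \<open>y\<close>; then
    \<open>x + d\<close> lies between two points of the interval.\<close>
  define d where "d = (if x < y then min (e/2) (y - x) else - min (e/2) (x - y))"
  have "x + d \<in> I"
  proof (cases "x < y")
    case True
    then have "x \<le> x + d" "x + d \<le> y"
      using e by (auto simp: d_def)
    then show ?thesis
      using assms(1) x y(1) by (meson is_interval_1)
  next
    case False
    then have "y \<le> x + d" "x + d \<le> x"
      using e y by (auto simp: d_def)
    then show ?thesis
      using assms(1) x y(1) by (meson is_interval_1)
  qed
  moreover have "0 < \<bar>d\<bar>" "\<bar>d\<bar> < e"
    using e y by (auto simp: d_def)
  ultimately show "\<exists>d. 0 < \<bar>d\<bar> \<and> \<bar>d\<bar> < e \<and> x + d *\<^sub>R i \<in> I"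
    using i by auto
qed

lemma thick_Times:
  assumes "thick A" "thick B"
  shows "thick (A \<times> B)"
  unfolding thick_def
proof (intro ballI allI impI)
  fix x i :: "'a \<times> 'b" and e :: real
  assume x: "x \<in> A \<times> B" and i: "i \<in> Basis" and e: "e > 0"
  from i consider u where "u \<in> Basis" "i = (u, 0)" | v where "v \<in> Basis" "i = (0, v)"
    by (auto simp: Basis_prod_def)
  then show "\<exists>d. 0 < \<bar>d\<bar> \<and> \<bar>d\<bar> < e \<and> x + d *\<^sub>R i \<in> A \<times> B"
  proof cases
    case 1
    then obtain d where "0 < \<bar>d\<bar>" "\<bar>d\<bar> < e" "fst x + d *\<^sub>R u \<in> A"
      using assms(1) x e unfolding thick_def by (metis mem_Times_iff)
    then show ?thesis
      using x 1 by (intro exI[of _ d]) (auto simp: mem_Times_iff)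
  next
    case 2
    then obtain d where "0 < \<bar>d\<bar>" "\<bar>d\<bar> < e" "snd x + d *\<^sub>R v \<in> B"
      using assms(2) x e unfolding thick_def by (metis mem_Times_iff)
    then show ?thesis
      using x 2 by (intro exI[of _ d]) (auto simp: mem_Times_iff)
  qed
qed

text \<open>\<open>thick\<close> is the condition of
  \<open>frechet_derivative_unique_within\<close>: small nonzero steps along every basis direction
  pin down the linear map. This is how computed derivatives become values of
  \<open>ddir\<close>.\<close>

lemma ddir_eq:
  assumes "thick S" "x \<in> S" "(f has_derivative f') (at x within S)"
  shows "ddir S f v x = f' v"
proof -
  have "(f has_derivative frechet_derivative f (at x within S)) (at x within S)"
    using assms(3) frechet_derivative_works unfolding differentiable_def by blast
  then have "frechet_derivative f (at x within S) = f'"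
    using assms unfolding thick_def by (intro frechet_derivative_unique_within) auto
  then show ?thesis by (simp add: ddir_def)
qed

lemma has_derivative_ddir:
  assumes "f differentiable_on S" "x \<in> S"
  shows "(f has_derivative (\<lambda>v. ddir S f v x)) (at x within S)"
  using assms frechet_derivative_works unfolding differentiable_on_def ddir_def by blast

lemma has_derivative_ddir_real:
  assumes "f differentiable_on S" "t \<in> S"
  shows "(f has_derivative (\<lambda>s. s *\<^sub>R ddir S f 1 t)) (at t within S)"
proof -
  have D: "(f has_derivative (\<lambda>v. ddir S f v t)) (at t within S)"
    by (rule has_derivative_ddir[OF assms])
  then interpret bounded_linear "\<lambda>v. ddir S f v t"
    by (rule has_derivative_bounded_linear)
  have "(\<lambda>v. ddir S f v t) = (\<lambda>s. s *\<^sub>R ddir S f 1 t)"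
  proof
    show "ddir S f s t = s *\<^sub>R ddir S f 1 t" for s
      using scaleR[of s 1] by simp
  qed
  then show ?thesis
    by (rule has_derivative_eq_rhs[OF D])
qed

lemma linear_ddir:
  assumes "f differentiable_on S" "x \<in> S"
  shows "linear (\<lambda>v. ddir S f v x)"
  using has_derivative_ddir[OF assms] by (rule has_derivative_linear)

text \<open>Both functions have the same derivatives within \<open>S\<close>, so the choice operator
  in \<open>frechet_derivative\<close> picks the same one.\<close>

lemma ddir_cong:
  assumes "\<And>y. y \<in> S \<Longrightarrow> f y = g y" "x \<in> S"
  shows "ddir S f v x = ddir S g v x"
proof -
  have "(f has_derivative D) (at x within S) \<longleftrightarrow> (g has_derivative D) (at x within S)" for D
    using assms by (metis has_derivative_transform)
  then show ?thesis by (simp add: ddir_def frechet_derivative_def)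
qed

lemma ddir_const: "thick S \<Longrightarrow> x \<in> S \<Longrightarrow> ddir S (\<lambda>_. c) v x = 0"
  by (rule ddir_eq) auto

lemma differentiable_on_cong:
  assumes "\<And>y. y \<in> S \<Longrightarrow> f y = g y"
  shows "f differentiable_on S \<longleftrightarrow> g differentiable_on S"
  using assms unfolding differentiable_on_def differentiable_def
  by (metis has_derivative_transform)

section \<open>Closure properties of \<open>Ck_on\<close> and \<open>smooth_on\<close>\<close>

lemma Ck_on_cong:
  assumes "\<And>y. y \<in> S \<Longrightarrow> f y = g y"
  shows "Ck_on k S f \<longleftrightarrow> Ck_on k S g"
  using assms
proof (induction k arbitrary: f g)
  case 0
  then show ?case by (simp cong: continuous_on_cong)
next
  case (Suc k)
  have "Ck_on k S (ddir S f v) \<longleftrightarrow> Ck_on k S (ddir S g v)" for v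
    by (intro Suc.IH ddir_cong Suc.prems)
  then show ?case
    using differentiable_on_cong[of S f g] Suc.prems by simp
qed

lemma Ck_on_Suc_imp: "Ck_on (Suc k) S f \<Longrightarrow> Ck_on k S f"
  by (induction k arbitrary: f) (auto simp: differentiable_imp_continuous_on)

lemma Ck_on_const:
  assumes "thick S"
  shows "Ck_on k S (\<lambda>_. c)"
proof (induction k arbitrary: c)
  case (Suc k)
  have "Ck_on k S (ddir S (\<lambda>_. c) v)" for v
    using Suc.IH[of 0] by (subst Ck_on_cong[of S]) (rule ddir_const[OF assms])
  then show ?case by simp
qed simp

lemma Ck_on_add:
  assumes "thick S" "Ck_on k S f" "Ck_on k S g"
  shows "Ck_on k S (\<lambda>x. f x + g x)"
  using assms(2,3)
proof (induction k arbitrary: f g)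
  case 0
  then show ?case by (auto intro: continuous_on_add continuous_on_scaleR)
next
  case (Suc k)
  then have d: "f differentiable_on S" "g differentiable_on S" by auto
  have "ddir S (\<lambda>x. f x + g x) v x = ddir S f v x + ddir S g v x" if "x \<in> S" for v x
    using ddir_eq[OF assms(1) that has_derivative_add[OF has_derivative_ddir[OF d(1) that]
        has_derivative_ddir[OF d(2) that]]] .
  moreover have "Ck_on k S (\<lambda>x. ddir S f v x + ddir S g v x)" for v
    using Suc by auto
  ultimately have "Ck_on k S (ddir S (\<lambda>x. f x + g x) v)" for v
    by (metis (no_types, lifting) Ck_on_cong)
  then show ?case
    using d by (auto intro: differentiable_on_add)
qed

lemma Ck_on_scaleR:
  assumes "thick S" "Ck_on k S f" "Ck_on k S g"
  shows "Ck_on k S (\<lambda>x. f x *\<^sub>R g x)"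
  using assms(2,3)
proof (induction k arbitrary: f g)
  case 0
  then show ?case by (auto intro: continuous_on_add continuous_on_scaleR)
next
  case (Suc k)
  then have d: "f differentiable_on S" "g differentiable_on S" by auto
  have D: "((\<lambda>x. f x *\<^sub>R g x) has_derivative (\<lambda>v. f x *\<^sub>R ddir S g v x + ddir S f v x *\<^sub>R g x))
      (at x within S)" if "x \<in> S" for x
    by (intro has_derivative_scaleR has_derivative_ddir d that)
  \<comment> \<open>The product rule leaves one factor undifferentiated;
    \<open>Ck_on_Suc_imp\<close> lowers its order to \<open>k\<close> so that the induction
    hypothesis applies.\<close>
  have "Ck_on k S (\<lambda>x. f x *\<^sub>R ddir S g v x + ddir S f v x *\<^sub>R g x)" for v
    using Suc.prems Suc.prems[THEN Ck_on_Suc_imp] by (intro Ck_on_add assms(1) Suc.IH) auto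
  moreover have "ddir S (\<lambda>x. f x *\<^sub>R g x) v x = f x *\<^sub>R ddir S g v x + ddir S f v x *\<^sub>R g x"
    if "x \<in> S" for v x
    using ddir_eq[OF assms(1) that D[OF that]] .
  ultimately have "Ck_on k S (ddir S (\<lambda>x. f x *\<^sub>R g x) v)" for v
    by (metis (no_types, lifting) Ck_on_cong)
  moreover have "(\<lambda>x. f x *\<^sub>R g x) differentiable_on S"
    using D unfolding differentiable_on_def differentiable_def by blast
  ultimately show ?case by simp
qed

lemma smooth_on_imp_differentiable_on: "smooth_on S f \<Longrightarrow> f differentiable_on S"
  unfolding smooth_on_def by (metis Ck_on.simps(2))

lemma smooth_on_ddir: "smooth_on S f \<Longrightarrow> smooth_on S (ddir S f v)"
  unfolding smooth_on_def by (metis Ck_on.simps(2))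

lemma smooth_on_const: "thick S \<Longrightarrow> smooth_on S (\<lambda>_. c)"
  by (simp add: smooth_on_def Ck_on_const)

lemma smooth_on_cong:
  assumes "\<And>y. y \<in> S \<Longrightarrow> f y = g y"
  shows "smooth_on S f \<longleftrightarrow> smooth_on S g"
  unfolding smooth_on_def using Ck_on_cong[of S f g] assms by blast

lemma smooth_on_scaleR:
  assumes "thick S" "smooth_on S f" "smooth_on S g"
  shows "smooth_on S (\<lambda>x. f x *\<^sub>R g x)"
  using assms Ck_on_scaleR unfolding smooth_on_def by blast

text \<open>Differentiate the constant function \<open>f y \<bullet> f y\<close>. Applied to
  \<open>\<gamma>\<close> and to the product map, this gives tangency of their first derivatives to
  the sphere.\<close>

lemma ddir_inner_eq_0_of_norm_eq_1:
  fixes f :: "'a::euclidean_space \<Rightarrow> 'b::real_inner"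
  assumes "thick S" "f differentiable_on S" "\<And>y. y \<in> S \<Longrightarrow> norm (f y) = 1" "x \<in> S"
  shows "ddir S f v x \<bullet> f x = 0"
proof -
  have "((\<lambda>y. f y \<bullet> f y) has_derivative (\<lambda>v. f x \<bullet> ddir S f v x + ddir S f v x \<bullet> f x))
      (at x within S)"
    by (intro has_derivative_inner has_derivative_ddir assms)
  then have "ddir S (\<lambda>y. f y \<bullet> f y) v x = f x \<bullet> ddir S f v x + ddir S f v x \<bullet> f x"
    by (rule ddir_eq[OF assms(1,4)])
  moreover have "ddir S (\<lambda>y. f y \<bullet> f y) v x = ddir S (\<lambda>_. 1) v x"
    using assms(3,4) by (intro ddir_cong) (simp_all add: dot_square_norm)
  ultimately show ?thesis
    by (simp add: ddir_const[OF assms(1,4)] inner_commute)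
qed

section \<open>Product maps\<close>

lemma bounded_bilinear_vector_scalar_mult:
  "bounded_bilinear ((*s) :: complex \<Rightarrow> complex^'n \<Rightarrow> complex^'n)"
  unfolding bilinear_conv_bounded_bilinear[symmetric] bilinear_def
  by (auto intro!: linearI simp: vec_eq_iff algebra_simps)

text \<open>In each coordinate, multiplying both arguments by the same complex number scales the
  real inner product by the squared modulus. The isometry property of
  \<open>(a, b) \<mapsto> (a *s f1 x, b *s f2 y)\<close> rests on this.\<close>

lemma inner_vector_scalar_mult:
  fixes f :: "complex^'n"
  shows "(a *s f) \<bullet> (b *s f) = (a \<bullet> b) * (norm f)\<^sup>2"
proof -
  have "(a * z) \<bullet> (b * z) = (a \<bullet> b) * (z \<bullet> z)" for z :: complex
    by (simp add: inner_complex_def algebra_simps)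
  then show ?thesis
    by (simp add: inner_vec_def power2_norm_eq_inner sum_distrib_left)
qed

lemma product_map_eq:
  "product_map a \<psi>1 \<psi>2
    = (\<lambda>w. (fst (a (fst w)) *s \<psi>1 (fst (snd w)), snd (a (fst w)) *s \<psi>2 (snd (snd w))))"
  by (rule ext) (simp add: product_map_def split_beta)

text \<open>The three terms of the product rule are written as product maps again, with the zero
  function in the factor that is not involved. Product maps are thus closed under differentiation up
  to sums, which drives the induction in \<open>Ck_on_product_map\<close>.\<close>

lemma has_derivative_product_map:
  fixes \<psi>1 :: "'a::euclidean_space \<Rightarrow> complex^'n1" and \<psi>2 :: "'b::euclidean_space \<Rightarrow> complex^'n2"
  assumes "a differentiable_on I" "\<psi>1 differentiable_on U1" "\<psi>2 differentiable_on U2"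
    and w: "w \<in> I \<times> U1 \<times> U2"
  shows "(product_map a \<psi>1 \<psi>2 has_derivative (\<lambda>v. product_map (ddir I a (fst v)) \<psi>1 \<psi>2 w
      + product_map a (ddir U1 \<psi>1 (fst (snd v))) (\<lambda>_. 0) w
      + product_map a (\<lambda>_. 0) (ddir U2 \<psi>2 (snd (snd v))) w)) (at w within I \<times> U1 \<times> U2)"
proof -
  let ?S = "I \<times> U1 \<times> U2"
  interpret s1: bounded_bilinear "(*s) :: complex \<Rightarrow> complex^'n1 \<Rightarrow> _"
    by (rule bounded_bilinear_vector_scalar_mult)
  interpret s2: bounded_bilinear "(*s) :: complex \<Rightarrow> complex^'n2 \<Rightarrow> _"
    by (rule bounded_bilinear_vector_scalar_mult)
  have A: "((\<lambda>v. a (fst v)) has_derivative (\<lambda>v. ddir I a (fst v) (fst w))) (at w within ?S)"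
    by (rule has_derivative_in_compose2[where t = I])
      (use assms has_derivative_ddir in \<open>auto intro!: derivative_eq_intros\<close>)
  have 1: "((\<lambda>v. \<psi>1 (fst (snd v))) has_derivative (\<lambda>v. ddir U1 \<psi>1 (fst (snd v)) (fst (snd w))))
      (at w within ?S)"
    by (rule has_derivative_in_compose2[where t = U1])
      (use assms has_derivative_ddir in \<open>auto intro!: derivative_eq_intros\<close>)
  have 2: "((\<lambda>v. \<psi>2 (snd (snd v))) has_derivative (\<lambda>v. ddir U2 \<psi>2 (snd (snd v)) (snd (snd w))))
      (at w within ?S)"
    by (rule has_derivative_in_compose2[where t = U2])
      (use assms has_derivative_ddir in \<open>auto intro!: derivative_eq_intros\<close>)
  have "((\<lambda>v. (fst (a (fst v)) *s \<psi>1 (fst (snd v)), snd (a (fst v)) *s \<psi>2 (snd (snd v))))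
      has_derivative (\<lambda>v.
        (fst (a (fst w)) *s ddir U1 \<psi>1 (fst (snd v)) (fst (snd w))
           + fst (ddir I a (fst v) (fst w)) *s \<psi>1 (fst (snd w)),
         snd (a (fst w)) *s ddir U2 \<psi>2 (snd (snd v)) (snd (snd w))
           + snd (ddir I a (fst v) (fst w)) *s \<psi>2 (snd (snd w))))) (at w within ?S)"
    by (rule has_derivative_Pair[OF s1.FDERIV[OF has_derivative_fst[OF A] 1]
          s2.FDERIV[OF has_derivative_snd[OF A] 2]])
  then show ?thesis
    unfolding product_map_eq
    by (rule has_derivative_eq_rhs) (simp add: fun_eq_iff add.commute)
qed

lemma product_map_differentiable_on:
  fixes \<psi>1 :: "'a::euclidean_space \<Rightarrow> complex^'n1" and \<psi>2 :: "'b::euclidean_space \<Rightarrow> complex^'n2"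
  assumes "a differentiable_on I" "\<psi>1 differentiable_on U1" "\<psi>2 differentiable_on U2"
  shows "product_map a \<psi>1 \<psi>2 differentiable_on I \<times> U1 \<times> U2"
  unfolding differentiable_on_def differentiable_def
  using has_derivative_product_map[OF assms] by blast

lemma ddir_product_map:
  fixes \<psi>1 :: "'a::euclidean_space \<Rightarrow> complex^'n1" and \<psi>2 :: "'b::euclidean_space \<Rightarrow> complex^'n2"
  assumes "thick (I \<times> U1 \<times> U2)"
    and "a differentiable_on I" "\<psi>1 differentiable_on U1" "\<psi>2 differentiable_on U2"
    and "w \<in> I \<times> U1 \<times> U2"
  shows "ddir (I \<times> U1 \<times> U2) (product_map a \<psi>1 \<psi>2) v w = product_map (ddir I a (fst v)) \<psi>1 \<psi>2 w
      + product_map a (ddir U1 \<psi>1 (fst (snd v))) (\<lambda>_. 0) w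
      + product_map a (\<lambda>_. 0) (ddir U2 \<psi>2 (snd (snd v))) w"
  by (rule ddir_eq[OF assms(1,5) has_derivative_product_map[OF assms(2-5)]])

lemma Ck_on_product_map:
  fixes \<psi>1 :: "'a::euclidean_space \<Rightarrow> complex^'n1" and \<psi>2 :: "'b::euclidean_space \<Rightarrow> complex^'n2"
  assumes th: "thick (I \<times> U1 \<times> U2)" "thick U1" "thick U2"
    and "Ck_on k I a" "Ck_on k U1 \<psi>1" "Ck_on k U2 \<psi>2"
  shows "Ck_on k (I \<times> U1 \<times> U2) (product_map a \<psi>1 \<psi>2)"
  using assms(4-6)
proof (induction k arbitrary: a \<psi>1 \<psi>2)
  case 0
  then have c: "continuous_on I a" "continuous_on U1 \<psi>1" "continuous_on U2 \<psi>2"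
    by auto
  have a: "continuous_on (I \<times> U1 \<times> U2) (\<lambda>v. a (fst v))"
    by (rule continuous_on_compose2[OF c(1) continuous_on_fst[OF continuous_on_id]]) auto
  have 1: "continuous_on (I \<times> U1 \<times> U2) (\<lambda>v. \<psi>1 (fst (snd v)))"
    by (rule continuous_on_compose2[OF c(2)
          continuous_on_fst[OF continuous_on_snd[OF continuous_on_id]]]) auto
  have 2: "continuous_on (I \<times> U1 \<times> U2) (\<lambda>v. \<psi>2 (snd (snd v)))"
    by (rule continuous_on_compose2[OF c(3)
          continuous_on_snd[OF continuous_on_snd[OF continuous_on_id]]]) auto
  show ?case
    unfolding product_map_eq Ck_on.simps
    by (intro continuous_on_Pair continuous_on_fst continuous_on_snd a 1 2
        bounded_bilinear.continuous_on[OF bounded_bilinear_vector_scalar_mult])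
next
  case (Suc k)
  then have d: "a differentiable_on I" "\<psi>1 differentiable_on U1" "\<psi>2 differentiable_on U2"
    by auto
  have lower: "Ck_on k I a" "Ck_on k U1 \<psi>1" "Ck_on k U2 \<psi>2"
    using Suc.prems by (blast dest: Ck_on_Suc_imp)+
  have "Ck_on k (I \<times> U1 \<times> U2) (\<lambda>w. product_map (ddir I a (fst v)) \<psi>1 \<psi>2 w
      + product_map a (ddir U1 \<psi>1 (fst (snd v))) (\<lambda>_. 0) w
      + product_map a (\<lambda>_. 0) (ddir U2 \<psi>2 (snd (snd v))) w)" for v
    using Suc.prems lower
    by (intro Ck_on_add th(1) Suc.IH Ck_on_const th) auto
  then have "Ck_on k (I \<times> U1 \<times> U2) (ddir (I \<times> U1 \<times> U2) (product_map a \<psi>1 \<psi>2) v)" for v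
    by (subst Ck_on_cong[of "I \<times> U1 \<times> U2"]) (rule ddir_product_map[OF th(1) d], assumption)
  then show ?case
    using product_map_differentiable_on[OF d] by simp
qed

section \<open>Inner products and traces\<close>

definition is_inner :: "('e::euclidean_space \<Rightarrow> 'e \<Rightarrow> real) \<Rightarrow> bool" where
  "is_inner b \<longleftrightarrow> bilinear b \<and> (\<forall>u v. b u v = b v u) \<and> (\<forall>u. u \<noteq> 0 \<longrightarrow> b u u > 0)"

context
  fixes b :: "'e::euclidean_space \<Rightarrow> 'e \<Rightarrow> real"
  assumes b: "is_inner b"
begin

lemma is_inner_linear: "linear (b u)" "linear (\<lambda>u. b u v)"
  using b by (auto simp: is_inner_def bilinear_def)

lemma coordinate_map_inner: "j \<in> Basis \<Longrightarrow> (\<Sum>j\<in>Basis. b u j *\<^sub>R j) \<bullet> j = b u j"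
  by (simp add: inner_sum_left inner_Basis if_distrib cong: if_cong)

lemma is_inner_eqI:
  assumes "\<And>j. j \<in> Basis \<Longrightarrow> b u j = b v j"
  shows "u = v"
proof (rule ccontr)
  assume "u \<noteq> v"
  then have "b (u - v) (u - v) > 0"
    using b by (simp add: is_inner_def)
  moreover have "b u = b v"
    by (rule linear_eq_stdbasis[OF is_inner_linear(1) is_inner_linear(1) assms])
  then have "b (u - v) (u - v) = 0"
    using linear_diff[OF is_inner_linear(2)] by simp
  ultimately show False by simp
qed

text \<open>Makes the \<open>inv\<close> in \<open>sharp\<close> a genuine inverse: positive
  definiteness gives injectivity, and a linear injection of a finite-dimensional space into itself
  is onto.\<close>

lemma bij_coordinate_map: "bij (\<lambda>u. \<Sum>j\<in>Basis. b u j *\<^sub>R j)"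
proof -
  let ?L = "\<lambda>u. \<Sum>j\<in>Basis. b u j *\<^sub>R j"
  have lin: "linear ?L"
    by (auto intro!: linearI simp: linear_add[OF is_inner_linear(2)]
        linear_scale[OF is_inner_linear(2)] scaleR_left_distrib sum.distrib scaleR_sum_right)
  have "inj ?L"
    by (rule injI, rule is_inner_eqI) (metis coordinate_map_inner)
  with linear_injective_imp_surjective[OF lin] show ?thesis
    by (simp add: bij_def)
qed

lemma inner_sharp: "b (sharp b w) v = w \<bullet> v"
proof -
  have "(\<Sum>j\<in>Basis. b (sharp b w) j *\<^sub>R j) = w"
    unfolding sharp_def using surj_f_inv_f[OF bij_is_surj[OF bij_coordinate_map]] .
  then have "b (sharp b w) j = w \<bullet> j" if "j \<in> Basis" for j
    using coordinate_map_inner[OF that, of "sharp b w"] by simp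
  then have "b (sharp b w) = (\<bullet>) w"
    by (intro linear_eq_stdbasis is_inner_linear bounded_linear.linear bounded_linear_inner_right)
  then show ?thesis by simp
qed

lemma sharp_eqI:
  assumes "\<And>v. b u v = w \<bullet> v"
  shows "sharp b w = u"
  by (rule is_inner_eqI) (simp add: assms inner_sharp)

lemma sharp_scaleR: "sharp b (c *\<^sub>R w) = c *\<^sub>R sharp b w"
  by (rule sharp_eqI) (simp add: linear_scale[OF is_inner_linear(2)] inner_sharp)

lemma sharp_0: "sharp b 0 = 0"
  by (rule sharp_eqI) (simp add: linear_0[OF is_inner_linear(2)])

text \<open>Expanding \<open>sharp b j\<close> in \<open>Basis\<close> turns the sum over
  \<open>i\<close> into \<open>b (sharp b j) j\<close>, which is \<open>j \<bullet> j\<close>. The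
  dimensions of the factors enter the tension field through this trace.\<close>

lemma gtrace_self: "gtrace b b = DIM('e)"
proof -
  have "(\<Sum>i\<in>Basis. ginv b i j * b i j) = 1" if j: "j \<in> Basis" for j
  proof -
    have "(\<Sum>i\<in>Basis. ginv b i j * b i j) = b (\<Sum>i\<in>Basis. (sharp b j \<bullet> i) *\<^sub>R i) j"
      by (simp add: linear_sum[OF is_inner_linear(2)] linear_scale[OF is_inner_linear(2)]
          ginv_def inner_commute)
    also have "\<dots> = 1"
      using j by (simp add: euclidean_representation inner_sharp)
    finally show ?thesis .
  qed
  then show ?thesis
    unfolding gtrace_def by (subst sum.swap) simp
qed

end

lemma gtrace_add: "gtrace b (\<lambda>u v. H u v + K u v) = gtrace b H + gtrace b K"
  by (simp add: gtrace_def scaleR_right_distrib sum.distrib)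

lemma gtrace_linear: "linear L \<Longrightarrow> gtrace b (\<lambda>u v. L (H u v)) = L (gtrace b H)"
  by (simp add: gtrace_def linear_sum linear_scale)

lemma gtrace_scaleR_const: "gtrace b (\<lambda>u v. c u v *\<^sub>R z) = gtrace b c *\<^sub>R z"
  by (rule gtrace_linear) (auto intro!: linearI simp: scaleR_left_distrib)

lemma sum_Basis_Times:
  fixes f :: "'a::euclidean_space \<times> 'b::euclidean_space \<Rightarrow> 'c::comm_monoid_add"
  shows "sum f Basis = (\<Sum>i\<in>Basis. f (i, 0)) + (\<Sum>i\<in>Basis. f (0, i))"
proof -
  have "inj_on (\<lambda>u. (u::'a, 0::'b)) Basis" "inj_on (\<lambda>u. (0::'a, u::'b)) Basis"
    by (auto intro!: inj_onI)
  then show ?thesis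
    unfolding Basis_prod_def
    by (subst sum.union_disjoint) (auto simp: sum.reindex)
qed

section \<open>The doubly warped metric in a chart\<close>

text \<open>The metric of \<open>warped_product\<close> in a single product chart, separated from
  the manifolds so that the local computation needs only two coordinate domains.\<close>

definition warped_metric ::
    "(real \<Rightarrow> real) \<Rightarrow> (real \<Rightarrow> real) \<Rightarrow> 'a metric \<Rightarrow> 'b metric \<Rightarrow> (real \<times> 'a \<times> 'b) metric" where
  "warped_metric l1 l2 g1 g2 = (\<lambda>(t, x, y) (r, u, v) (r', u', v').
     r * r' + (l1 t)\<^sup>2 * g1 x u u' + (l2 t)\<^sup>2 * g2 y v v')"

locale warped_chart =
  fixes I :: "real set" and U1 :: "'a::euclidean_space set" and U2 :: "'b::euclidean_space set"
    and l1 l2 dl1 dl2 :: "real \<Rightarrow> real" and g1 :: "'a metric" and g2 :: "'b metric"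
  assumes thick_I: "thick I" and open_U1: "open U1" and open_U2: "open U2"
    and l1: "\<And>t. t \<in> I \<Longrightarrow> l1 t > 0"
      "\<And>t. t \<in> I \<Longrightarrow> (l1 has_real_derivative dl1 t) (at t within I)"
    and l2: "\<And>t. t \<in> I \<Longrightarrow> l2 t > 0"
      "\<And>t. t \<in> I \<Longrightarrow> (l2 has_real_derivative dl2 t) (at t within I)"
    and g1: "\<And>x. x \<in> U1 \<Longrightarrow> is_inner (g1 x)" "\<And>u v. (\<lambda>x. g1 x u v) differentiable_on U1"
    and g2: "\<And>y. y \<in> U2 \<Longrightarrow> is_inner (g2 y)" "\<And>u v. (\<lambda>y. g2 y u v) differentiable_on U2"
begin

abbreviation "S \<equiv> I \<times> U1 \<times> U2"
abbreviation "g \<equiv> warped_metric l1 l2 g1 g2"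

lemma thick_U1: "thick U1" and thick_U2: "thick U2" and thick_S: "thick S"
  by (auto intro: thick_open open_U1 open_U2 thick_Times thick_I)

lemma ddir_metric:
  assumes "(t, x, y) \<in> S"
  shows "ddir S (\<lambda>w. g w (r, u, v) (r', u', v')) (s, a, c) (t, x, y)
    = 2 * l1 t * dl1 t * s * g1 x u u' + (l1 t)\<^sup>2 * ddir U1 (\<lambda>x. g1 x u u') a x
    + 2 * l2 t * dl2 t * s * g2 y v v' + (l2 t)\<^sup>2 * ddir U2 (\<lambda>y. g2 y v v') c y"
proof -
  define p where "p = (t, x, y)"
  have p: "p \<in> S" using assms by (simp add: p_def)
  have L1: "((\<lambda>w. l1 (fst w)) has_derivative (\<lambda>h. dl1 (fst p) * fst h)) (at p within S)"
    by (rule has_derivative_in_compose2[where t = I and g' = "\<lambda>t h. dl1 t * h"])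
      (use p l1(2) in \<open>auto simp: has_field_derivative_def intro!: derivative_eq_intros\<close>)
  have L2: "((\<lambda>w. l2 (fst w)) has_derivative (\<lambda>h. dl2 (fst p) * fst h)) (at p within S)"
    by (rule has_derivative_in_compose2[where t = I and g' = "\<lambda>t h. dl2 t * h"])
      (use p l2(2) in \<open>auto simp: has_field_derivative_def intro!: derivative_eq_intros\<close>)
  have G1: "((\<lambda>w. g1 (fst (snd w)) u u') has_derivative
      (\<lambda>h. ddir U1 (\<lambda>x. g1 x u u') (fst (snd h)) (fst (snd p)))) (at p within S)"
    by (rule has_derivative_in_compose2[where t = U1
          and g' = "\<lambda>x h. ddir U1 (\<lambda>x. g1 x u u') h x"])
      (use p has_derivative_ddir[OF g1(2)] in \<open>auto intro!: derivative_eq_intros\<close>)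
  have G2: "((\<lambda>w. g2 (snd (snd w)) v v') has_derivative
      (\<lambda>h. ddir U2 (\<lambda>y. g2 y v v') (snd (snd h)) (snd (snd p)))) (at p within S)"
    by (rule has_derivative_in_compose2[where t = U2
          and g' = "\<lambda>y h. ddir U2 (\<lambda>y. g2 y v v') h y"])
      (use p has_derivative_ddir[OF g2(2)] in \<open>auto intro!: derivative_eq_intros\<close>)
  have eq: "(\<lambda>w. g w (r, u, v) (r', u', v')) =
      (\<lambda>w. r * r' + (l1 (fst w) * l1 (fst w)) * g1 (fst (snd w)) u u'
        + (l2 (fst w) * l2 (fst w)) * g2 (snd (snd w)) v v')"
    by (rule ext) (simp add: warped_metric_def split_beta power2_eq_square)
  note D = has_derivative_add[OF has_derivative_add[OF has_derivative_const
        has_derivative_mult[OF has_derivative_mult[OF L1 L1] G1]]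
      has_derivative_mult[OF has_derivative_mult[OF L2 L2] G2]]
  show ?thesis
    unfolding eq
    by (subst ddir_eq[OF thick_S p D, unfolded p_def])
      (simp add: algebra_simps power2_eq_square)
qed

context
  fixes t :: real and x :: 'a and y :: 'b
  assumes w: "t \<in> I" "x \<in> U1" "y \<in> U2"
begin

lemma is_inner_warped: "is_inner (g (t, x, y))"
proof -
  note lin = is_inner_linear[OF g1(1)[OF w(2)]] is_inner_linear[OF g2(1)[OF w(3)]]
  have bil: "bilinear (g (t, x, y))"
    unfolding bilinear_def warped_metric_def
    by (auto intro!: linearI
        simp: linear_add[OF lin(1)] linear_add[OF lin(2)] linear_add[OF lin(3)] linear_add[OF lin(4)]
          linear_scale[OF lin(1)] linear_scale[OF lin(2)] linear_scale[OF lin(3)]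
          linear_scale[OF lin(4)] algebra_simps)
  have sym: "g1 x u u' = g1 x u' u" "g2 y v v' = g2 y v' v" for u u' v v'
    using g1(1)[OF w(2)] g2(1)[OF w(3)] by (auto simp: is_inner_def)
  have nn1: "0 \<le> g1 x u u" "u \<noteq> 0 \<Longrightarrow> 0 < g1 x u u" for u
    using g1(1)[OF w(2)] linear_0[OF lin(1)] by (cases "u = 0"; force simp: is_inner_def)+
  have nn2: "0 \<le> g2 y u u" "u \<noteq> 0 \<Longrightarrow> 0 < g2 y u u" for u
    using g2(1)[OF w(3)] linear_0[OF lin(3)] by (cases "u = 0"; force simp: is_inner_def)+
  have "0 < r * r + (l1 t)\<^sup>2 * g1 x u u + (l2 t)\<^sup>2 * g2 y v v" if "(r, u, v) \<noteq> 0" for r u v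
  proof -
    have "0 \<le> r * r" "0 \<le> (l1 t)\<^sup>2 * g1 x u u" "0 \<le> (l2 t)\<^sup>2 * g2 y v v"
      using nn1 nn2 by auto
    moreover have "0 < r * r \<or> 0 < (l1 t)\<^sup>2 * g1 x u u \<or> 0 < (l2 t)\<^sup>2 * g2 y v v"
      using that nn1(2)[of u] nn2(2)[of v] l1(1)[OF w(1)] l2(1)[OF w(1)]
      by (auto simp: zero_prod_def zero_less_mult_iff)
    ultimately show ?thesis by linarith
  qed
  with bil show ?thesis
    unfolding is_inner_def by (auto simp: warped_metric_def sym)
qed

lemma sharp_warped:
  "sharp (g (t, x, y)) (r, u, v)
    = (r, (1 / (l1 t)\<^sup>2) *\<^sub>R sharp (g1 x) u, (1 / (l2 t)\<^sup>2) *\<^sub>R sharp (g2 y) v)"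
proof (rule sharp_eqI[OF is_inner_warped])
  fix z :: "real \<times> 'a \<times> 'b"
  show "g (t, x, y) (r, (1 / (l1 t)\<^sup>2) *\<^sub>R sharp (g1 x) u, (1 / (l2 t)\<^sup>2) *\<^sub>R sharp (g2 y) v) z
      = (r, u, v) \<bullet> z"
    using l1(1)[OF w(1)] l2(1)[OF w(1)] g1(1)[OF w(2)] g2(1)[OF w(3)]
    by (cases z) (simp add: warped_metric_def linear_scale[OF is_inner_linear(2)] inner_sharp)
qed

text \<open>\<open>sharp_warped\<close> preserves the three blocks, so the trace never sees a mixed
  value of \<open>H\<close>. Hence only the Christoffel symbols and second derivatives with both
  arguments in the same factor are computed below.\<close>

lemma gtrace_warped:
  "gtrace (g (t, x, y)) H = H (1, 0, 0) (1, 0, 0)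
    + (1 / (l1 t)\<^sup>2) *\<^sub>R gtrace (g1 x) (\<lambda>u v. H (0, u, 0) (0, v, 0))
    + (1 / (l2 t)\<^sup>2) *\<^sub>R gtrace (g2 y) (\<lambda>u v. H (0, 0, u) (0, 0, v))"
  using sharp_0[OF g1(1)[OF w(2)]] sharp_0[OF g2(1)[OF w(3)]]
  unfolding gtrace_def ginv_def
  by (simp add: sum_Basis_Times sharp_warped scaleR_sum_right zero_prod_def)

text \<open>Rewrite rules that discard the mixed terms when the Koszul formula is evaluated on
  vectors from one factor.\<close>

lemma ddir_metric_0:
  "ddir U1 (\<lambda>x. g1 x 0 u) a x = 0" "ddir U1 (\<lambda>x. g1 x u 0) a x = 0"
  "ddir U2 (\<lambda>y. g2 y 0 v) c y = 0" "ddir U2 (\<lambda>y. g2 y v 0) c y = 0"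
  "g1 x 0 u = 0" "g1 x u 0 = 0" "g2 y 0 v = 0" "g2 y v 0 = 0"
proof -
  have 1: "g1 x 0 u = 0" "g1 x u 0 = 0" if "x \<in> U1" for x u
    using linear_0[OF is_inner_linear(1)[OF g1(1)[OF that]]]
      linear_0[OF is_inner_linear(2)[OF g1(1)[OF that]]] by auto
  have 2: "g2 x 0 u = 0" "g2 x u 0 = 0" if "x \<in> U2" for x u
    using linear_0[OF is_inner_linear(1)[OF g2(1)[OF that]]]
      linear_0[OF is_inner_linear(2)[OF g2(1)[OF that]]] by auto
  note c = ddir_const[OF thick_U1 w(2), of 0] ddir_const[OF thick_U2 w(3), of 0]
  show "ddir U1 (\<lambda>x. g1 x 0 u) a x = 0"
    using ddir_cong[of U1 "\<lambda>x. g1 x 0 u" "\<lambda>_. 0"] 1 c w by simp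
  show "ddir U1 (\<lambda>x. g1 x u 0) a x = 0"
    using ddir_cong[of U1 "\<lambda>x. g1 x u 0" "\<lambda>_. 0"] 1 c w by simp
  show "ddir U2 (\<lambda>x. g2 x 0 v) c y = 0"
    using ddir_cong[of U2 "\<lambda>x. g2 x 0 v" "\<lambda>_. 0"] 2 c w by simp
  show "ddir U2 (\<lambda>x. g2 x v 0) c y = 0"
    using ddir_cong[of U2 "\<lambda>x. g2 x v 0" "\<lambda>_. 0"] 2 c w by simp
  show "g1 x 0 u = 0" "g1 x u 0 = 0" "g2 y 0 v = 0" "g2 y v 0 = 0"
    using 1 2 w by auto
qed

lemma linear_ddir_metric:
  "ddir U1 (\<lambda>x. g1 x u v) 0 x = 0" "ddir U2 (\<lambda>y. g2 y u' v') 0 y = 0"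
  using linear_0[OF linear_ddir[OF g1(2) w(2)]] linear_0[OF linear_ddir[OF g2(2) w(3)]] .

text \<open>The lines with \<open>x\<close> and \<open>y\<close> fixed are geodesics: the
  coefficient of dt^2 is constant and the metric has no mixed terms.\<close>

lemma christoffel_warped_tt: "christoffel S g (t, x, y) (1, 0, 0) (1, 0, 0) = 0"
  using w
  by (simp add: christoffel_def sum_Basis_Times zero_prod_def ddir_metric ddir_metric_0
      linear_ddir_metric sum_prod sharp_0[OF is_inner_warped, unfolded zero_prod_def])

text \<open>The component along \<open>I\<close> is minus half the t-derivative of
  \<open>(l1 t)\<^sup>2 * g1 x u v\<close>. In the component along the first factor the scale
  \<open>(l1 t)\<^sup>2\<close> cancels against the one in \<open>sharp_warped\<close>, leaving the
  symbol of \<open>g1\<close> itself.\<close>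

lemma christoffel_warped_11:
  "christoffel S g (t, x, y) (0, u, 0) (0, v, 0)
    = (- l1 t * dl1 t * g1 x u v, christoffel U1 g1 x u v, 0)"
proof -
  let ?C = "\<lambda>l. (ddir U1 (\<lambda>y. g1 y v l) u x + ddir U1 (\<lambda>y. g1 y u l) v x
    - ddir U1 (\<lambda>y. g1 y u v) l x) / 2"
  have "christoffel S g (t, x, y) (0, u, 0) (0, v, 0) = sharp (g (t, x, y))
      (- l1 t * dl1 t * g1 x u v, (l1 t)\<^sup>2 *\<^sub>R (\<Sum>l\<in>Basis. ?C l *\<^sub>R l), 0)"
    using w
    by (simp add: christoffel_def sum_Basis_Times zero_prod_def ddir_metric ddir_metric_0
        linear_ddir_metric sum_prod scaleR_sum_right algebra_simps diff_divide_distrib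
        add_divide_distrib)
  then show ?thesis
    using l1(1)[OF w(1)] sharp_0[OF g2(1)[OF w(3)]]
    by (simp add: sharp_warped sharp_scaleR[OF g1(1)[OF w(2)]] christoffel_def)
qed

lemma christoffel_warped_22:
  "christoffel S g (t, x, y) (0, 0, u) (0, 0, v)
    = (- l2 t * dl2 t * g2 y u v, 0, christoffel U2 g2 y u v)"
proof -
  let ?C = "\<lambda>l. (ddir U2 (\<lambda>y. g2 y v l) u y + ddir U2 (\<lambda>y. g2 y u l) v y
    - ddir U2 (\<lambda>y. g2 y u v) l y) / 2"
  have "christoffel S g (t, x, y) (0, 0, u) (0, 0, v) = sharp (g (t, x, y))
      (- l2 t * dl2 t * g2 y u v, 0, (l2 t)\<^sup>2 *\<^sub>R (\<Sum>l\<in>Basis. ?C l *\<^sub>R l))"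
    using w
    by (simp add: christoffel_def sum_Basis_Times zero_prod_def ddir_metric ddir_metric_0
        linear_ddir_metric sum_prod scaleR_sum_right algebra_simps diff_divide_distrib
        add_divide_distrib)
  then show ?thesis
    using l2(1)[OF w(1)] sharp_0[OF g1(1)[OF w(2)]]
    by (simp add: sharp_warped sharp_scaleR[OF g2(1)[OF w(3)]] christoffel_def)
qed

end

end

section \<open>The tension field of a product map\<close>

lemma linear_sphere_proj: "linear (sphere_proj p)"
  by (auto intro!: linearI simp: sphere_proj_def inner_add_left algebra_simps)

lemma sphere_proj_tangent: "v \<bullet> p = 0 \<Longrightarrow> sphere_proj p v = v"
  by (simp add: sphere_proj_def)

lemma sphere_proj_self: "norm p = 1 \<Longrightarrow> sphere_proj p p = 0"
  by (simp add: sphere_proj_def dot_square_norm)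

lemma product_map_apply:
  "product_map a \<psi>1 \<psi>2 (t, x, y) = (fst (a t) *s \<psi>1 x, snd (a t) *s \<psi>2 y)"
  by (simp add: product_map_eq)

lemma norm_product_map:
  fixes \<psi>1 :: "'a \<Rightarrow> complex^'n1" and \<psi>2 :: "'b \<Rightarrow> complex^'n2"
  assumes "norm (\<psi>1 x) = 1" "norm (\<psi>2 y) = 1"
  shows "norm (product_map c \<psi>1 \<psi>2 (t, x, y)) = norm (c t)"
  using assms
  by (simp add: product_map_eq norm_eq_sqrt_inner[of "(_, _)"] norm_eq_sqrt_inner[of "c t"]
      inner_vector_scalar_mult inner_prod_def)

context warped_chart
begin

context
  fixes \<phi>1 :: "'a \<Rightarrow> complex^'n1" and \<phi>2 :: "'b \<Rightarrow> complex^'n2"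
    and \<gamma> :: "real \<Rightarrow> complex \<times> complex" and d1 d2 :: real
  assumes \<gamma>: "smooth_on I \<gamma>" "\<And>t. t \<in> I \<Longrightarrow> norm (\<gamma> t) = 1"
    and \<phi>1: "smooth_on U1 \<phi>1" "\<And>x. x \<in> U1 \<Longrightarrow> norm (\<phi>1 x) = 1"
      "\<And>x. x \<in> U1 \<Longrightarrow> coord_laplacian U1 g1 \<phi>1 x = - (d1 *\<^sub>R \<phi>1 x)"
    and \<phi>2: "smooth_on U2 \<phi>2" "\<And>y. y \<in> U2 \<Longrightarrow> norm (\<phi>2 y) = 1"
      "\<And>y. y \<in> U2 \<Longrightarrow> coord_laplacian U2 g2 \<phi>2 y = - (d2 *\<^sub>R \<phi>2 y)"
begin

abbreviation "G \<equiv> product_map \<gamma> \<phi>1 \<phi>2"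

lemmas diffs =
  smooth_on_imp_differentiable_on[OF \<gamma>(1)] smooth_on_imp_differentiable_on[OF smooth_on_ddir[OF \<gamma>(1)]]
  smooth_on_imp_differentiable_on[OF \<phi>1(1)] smooth_on_imp_differentiable_on[OF smooth_on_ddir[OF \<phi>1(1)]]
  smooth_on_imp_differentiable_on[OF \<phi>2(1)] smooth_on_imp_differentiable_on[OF smooth_on_ddir[OF \<phi>2(1)]]

lemmas ddir_0 = linear_0[OF linear_ddir[OF diffs(1)]] linear_0[OF linear_ddir[OF diffs(2)]]
  linear_0[OF linear_ddir[OF diffs(3)]] linear_0[OF linear_ddir[OF diffs(4)]]
  linear_0[OF linear_ddir[OF diffs(5)]] linear_0[OF linear_ddir[OF diffs(6)]]

text \<open>In the direction of a single factor only one of the three terms of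
  \<open>ddir_product_map\<close> survives, so the first derivative is again a product map and the
  formula can be applied a second time.\<close>

lemma ddir_ddir_product_map:
  assumes "(t, x, y) \<in> S"
  shows "ddir S (ddir S G (1, 0, 0)) (1, 0, 0) (t, x, y)
      = product_map (ddir I (ddir I \<gamma> 1) 1) \<phi>1 \<phi>2 (t, x, y)"
    and "ddir S (ddir S G (0, v, 0)) (0, u, 0) (t, x, y)
      = (fst (\<gamma> t) *s ddir U1 (ddir U1 \<phi>1 v) u x, 0)"
    and "ddir S (ddir S G (0, 0, v')) (0, 0, u') (t, x, y)
      = (0, snd (\<gamma> t) *s ddir U2 (ddir U2 \<phi>2 v') u' y)"
proof -
  have c: "(\<lambda>_. 0) differentiable_on U1" "(\<lambda>_. 0) differentiable_on U2"
    by auto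
  note D = ddir_product_map[OF thick_S]
  have "ddir S (ddir S G (1, 0, 0)) (1, 0, 0) (t, x, y)
      = ddir S (product_map (ddir I \<gamma> 1) \<phi>1 \<phi>2) (1, 0, 0) (t, x, y)"
    by (rule ddir_cong[OF _ assms]) (auto simp: D[OF diffs(1,3,5)] product_map_apply ddir_0 simp flip: zero_prod_def)
  also have "\<dots> = product_map (ddir I (ddir I \<gamma> 1) 1) \<phi>1 \<phi>2 (t, x, y)"
    using assms by (auto simp: D[OF diffs(2,3,5)] product_map_apply ddir_0 simp flip: zero_prod_def)
  finally show "ddir S (ddir S G (1, 0, 0)) (1, 0, 0) (t, x, y)
      = product_map (ddir I (ddir I \<gamma> 1) 1) \<phi>1 \<phi>2 (t, x, y)" .
  have "ddir S (ddir S G (0, v, 0)) (0, u, 0) (t, x, y)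
      = ddir S (product_map \<gamma> (ddir U1 \<phi>1 v) (\<lambda>_. 0)) (0, u, 0) (t, x, y)"
    by (rule ddir_cong[OF _ assms]) (auto simp: D[OF diffs(1,3,5)] product_map_apply ddir_0 simp flip: zero_prod_def)
  also have "\<dots> = (fst (\<gamma> t) *s ddir U1 (ddir U1 \<phi>1 v) u x, 0)"
    using assms by (auto simp: D[OF diffs(1,4) c(2)] product_map_apply ddir_0 ddir_const thick_U2 simp flip: zero_prod_def)
  finally show "ddir S (ddir S G (0, v, 0)) (0, u, 0) (t, x, y)
      = (fst (\<gamma> t) *s ddir U1 (ddir U1 \<phi>1 v) u x, 0)" .
  have "ddir S (ddir S G (0, 0, v')) (0, 0, u') (t, x, y)
      = ddir S (product_map \<gamma> (\<lambda>_. 0) (ddir U2 \<phi>2 v')) (0, 0, u') (t, x, y)"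
    by (rule ddir_cong[OF _ assms]) (auto simp: D[OF diffs(1,3,5)] product_map_apply ddir_0 simp flip: zero_prod_def)
  also have "\<dots> = (0, snd (\<gamma> t) *s ddir U2 (ddir U2 \<phi>2 v') u' y)"
    using assms by (auto simp: D[OF diffs(1) c(1) diffs(6)] product_map_apply ddir_0 ddir_const thick_U1 simp flip: zero_prod_def)
  finally show "ddir S (ddir S G (0, 0, v')) (0, 0, u') (t, x, y)
      = (0, snd (\<gamma> t) *s ddir U2 (ddir U2 \<phi>2 v') u' y)" .
qed

lemma coord_tension_product_map:
  assumes w: "t \<in> I" "x \<in> U1" "y \<in> U2"
  shows "coord_tension S g G (t, x, y) = product_map (\<lambda>t. sphere_proj (\<gamma> t)
      (ddir I (ddir I \<gamma> 1) 1 t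
        + (real DIM('a) * dl1 t / l1 t + real DIM('b) * dl2 t / l2 t) *\<^sub>R ddir I \<gamma> 1 t
        - ((d1 / (l1 t)\<^sup>2) *\<^sub>R fst (\<gamma> t), (d2 / (l2 t)\<^sup>2) *\<^sub>R snd (\<gamma> t)))) \<phi>1 \<phi>2 (t, x, y)"
proof -
  interpret s1: bounded_bilinear "(*s) :: complex \<Rightarrow> complex^'n1 \<Rightarrow> _"
    by (rule bounded_bilinear_vector_scalar_mult)
  interpret s2: bounded_bilinear "(*s) :: complex \<Rightarrow> complex^'n2 \<Rightarrow> _"
    by (rule bounded_bilinear_vector_scalar_mult)
  define p where "p = (t, x, y)"
  have p: "p \<in> S" using w by (simp add: p_def)
  \<comment> \<open>\<open>J\<close> is the isometry at the point \<open>(x, y)\<close>.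
    \<open>E1\<close> and \<open>E2\<close> carry derivatives of \<open>\<phi>1\<close> and
    \<open>\<phi>2\<close> into the target, with the coefficients frozen at
    \<open>\<gamma> t\<close>.\<close>
  define J where "J c = (fst c *s \<phi>1 x, snd c *s \<phi>2 y)" for c
  define E1 :: "complex^'n1 \<Rightarrow> (complex^'n1) \<times> (complex^'n2)" where "E1 z = (fst (\<gamma> t) *s z, 0)" for z
  define E2 :: "complex^'n2 \<Rightarrow> (complex^'n1) \<times> (complex^'n2)" where "E2 z = (0, snd (\<gamma> t) *s z)" for z
  have J: "product_map c \<phi>1 \<phi>2 p = J (c t)" for c
    by (simp add: product_map_eq J_def p_def)
  have linJ: "linear J"
    by (auto intro!: linearI simp: J_def s1.add_left s2.add_left s1.scaleR_left s2.scaleR_left)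
  have linE: "linear E1" "linear E2"
    by (auto intro!: linearI simp: E1_def E2_def s1.add_right s2.add_right
        s1.scaleR_right s2.scaleR_right)
  have innerJ: "J c \<bullet> J c' = c \<bullet> c'" for c c'
    using \<phi>1(2)[OF w(2)] \<phi>2(2)[OF w(3)] by (simp add: J_def inner_prod_def inner_vector_scalar_mult)
  \<comment> \<open>An isometry sending \<open>\<gamma> t\<close> to \<open>G p\<close> intertwines
    the projections at these two points, so the whole computation can be moved back to the
    3-sphere.\<close>
  have projJ: "sphere_proj (G p) (J c) = J (sphere_proj (\<gamma> t) c)" for c
    by (simp add: J sphere_proj_def innerJ linear_diff[OF linJ] linear_scale[OF linJ])
  let ?P = "sphere_proj (G p)"
  note linP = linear_sphere_proj[of "G p"]
  let ?A = "ddir I \<gamma> 1 t"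
  have tang: "sphere_proj (\<gamma> t) ?A = ?A"
    by (intro sphere_proj_tangent ddir_inner_eq_0_of_norm_eq_1 thick_I diffs \<gamma> w)
  have DG: "ddir S G (r, u, v) p = r *\<^sub>R J ?A + E1 (ddir U1 \<phi>1 u x) + E2 (ddir U2 \<phi>2 v y)" for r u v
  proof -
    have "ddir I \<gamma> r t = r *\<^sub>R ?A"
      using linear_scale[OF linear_ddir[OF diffs(1) w(1)], of r 1] by simp
    then show ?thesis
      using ddir_product_map[OF thick_S diffs(1,3,5) p, of "(r, u, v)"]
      by (simp add: J linear_scale[OF linJ]) (simp add: product_map_eq E1_def E2_def p_def)
  qed
  have normG: "norm (G q) = 1" if "q \<in> S" for q
    using that \<gamma>(2) \<phi>1(2) \<phi>2(2) by (cases q) (simp add: norm_product_map)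
  have "ddir S G v p \<bullet> G p = 0" for v
    by (rule ddir_inner_eq_0_of_norm_eq_1[OF thick_S product_map_differentiable_on[OF diffs(1,3,5)]
          normG p])
  then have tangG: "?P (ddir S G v p) = ddir S G v p" for v
    by (simp add: sphere_proj_tangent)
  \<comment> \<open>This tangency allows the projection in front of the Christoffel term of each
    factor, so that the full Hessian of \<open>\<phi>1\<close> stands under it and its trace is the
    Laplacian.\<close>
  have tang1: "?P (E1 (ddir U1 \<phi>1 u x)) = E1 (ddir U1 \<phi>1 u x)" for u
    using tangG[of "(0, u, 0)"] w by (simp add: DG ddir_0 linear_0[OF linE(2)])
  have tang2: "?P (E2 (ddir U2 \<phi>2 u y)) = E2 (ddir U2 \<phi>2 u y)" for u
    using tangG[of "(0, 0, u)"] w by (simp add: DG ddir_0 linear_0[OF linE(1)])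
  note dd = ddir_ddir_product_map[of t x y, folded p_def, OF p]
  define H where "H u v = ?P (ddir S (ddir S G v) u p) - ddir S G (christoffel S g p u v) p" for u v
  have H0: "H (1, 0, 0) (1, 0, 0) = ?P (J (ddir I (ddir I \<gamma> 1) 1 t))"
    using linear_0[OF linear_ddir[OF product_map_differentiable_on[OF diffs(1,3,5)] p]]
    by (simp add: H_def dd J christoffel_warped_tt[OF w, folded p_def])
  \<comment> \<open>The component of the Christoffel vector along \<open>I\<close> differentiates
    \<open>\<gamma>\<close>; subtracted, it gives the multiple of \<open>J ?A\<close>. Its factor
    \<open>g1 x u v\<close> becomes the dimension when the trace is taken in
    \<open>T1\<close>.\<close>
  have H1: "H (0, u, 0) (0, v, 0)
      = ?P (E1 (ddir U1 (ddir U1 \<phi>1 v) u x - ddir U1 \<phi>1 (christoffel U1 g1 x u v) x))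
        + g1 x u v *\<^sub>R ((l1 t * dl1 t) *\<^sub>R J ?A)" for u v
    using w
    by (simp add: H_def dd(2) christoffel_warped_11[OF w, folded p_def] DG ddir_0
        linear_0[OF linE(2)] linear_diff[OF linE(1)] linear_diff[OF linP] tang1
        E1_def[symmetric] mult.commute mult.left_commute)
  have H2: "H (0, 0, u) (0, 0, v)
      = ?P (E2 (ddir U2 (ddir U2 \<phi>2 v) u y - ddir U2 \<phi>2 (christoffel U2 g2 y u v) y))
        + g2 y u v *\<^sub>R ((l2 t * dl2 t) *\<^sub>R J ?A)" for u v
    using w
    by (simp add: H_def dd(3) christoffel_warped_22[OF w, folded p_def] DG ddir_0
        linear_0[OF linE(1)] linear_diff[OF linE(2)] linear_diff[OF linP] tang2
        E2_def[symmetric] mult.commute mult.left_commute)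
  have T1: "gtrace (g1 x) (\<lambda>u v. H (0, u, 0) (0, v, 0))
      = ?P (E1 (- (d1 *\<^sub>R \<phi>1 x))) + real DIM('a) *\<^sub>R ((l1 t * dl1 t) *\<^sub>R J ?A)"
    unfolding H1 gtrace_add gtrace_scaleR_const gtrace_self[OF g1(1)[OF w(2)]]
      \<phi>1(3)[OF w(2), symmetric] coord_laplacian_def
    by (subst gtrace_linear[OF linear_compose[OF linE(1) linP], unfolded o_def]) simp
  have T2: "gtrace (g2 y) (\<lambda>u v. H (0, 0, u) (0, 0, v))
      = ?P (E2 (- (d2 *\<^sub>R \<phi>2 y))) + real DIM('b) *\<^sub>R ((l2 t * dl2 t) *\<^sub>R J ?A)"
    unfolding H2 gtrace_add gtrace_scaleR_const gtrace_self[OF g2(1)[OF w(3)]]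
      \<phi>2(3)[OF w(3), symmetric] coord_laplacian_def
    by (subst gtrace_linear[OF linear_compose[OF linE(2) linP], unfolded o_def]) simp
  have E1: "E1 (- (d1 *\<^sub>R \<phi>1 x)) = J (- d1 *\<^sub>R fst (\<gamma> t), 0)"
    by (simp add: E1_def J_def s1.minus_left s1.scaleR_left s1.minus_right s1.scaleR_right)
  have E2: "E2 (- (d2 *\<^sub>R \<phi>2 y)) = J (0, - d2 *\<^sub>R snd (\<gamma> t))"
    by (simp add: E2_def J_def s2.minus_left s2.scaleR_left s2.minus_right s2.scaleR_right)
  have pos: "l1 t \<noteq> 0" "l2 t \<noteq> 0"
    using l1(1)[OF w(1)] l2(1)[OF w(1)] by auto
  have "coord_tension S g G p = gtrace (g p) H"
    by (simp add: coord_tension_def H_def[abs_def])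
  also have "\<dots> = J (sphere_proj (\<gamma> t) (ddir I (ddir I \<gamma> 1) 1 t)
      + (1 / (l1 t)\<^sup>2) *\<^sub>R (sphere_proj (\<gamma> t) (- d1 *\<^sub>R fst (\<gamma> t), 0) + real DIM('a) *\<^sub>R ((l1 t * dl1 t) *\<^sub>R ?A))
      + (1 / (l2 t)\<^sup>2) *\<^sub>R (sphere_proj (\<gamma> t) (0, - d2 *\<^sub>R snd (\<gamma> t)) + real DIM('b) *\<^sub>R ((l2 t * dl2 t) *\<^sub>R ?A)))"
    by (simp only: gtrace_warped[OF w, folded p_def] H0 T1 T2 E1 E2 projJ linear_add[OF linJ]
        linear_scale[OF linJ])
  \<comment> \<open>\<open>tang\<close> brings the first-order terms under the projection, which
    then acts on a single vector.\<close>
  also have "\<dots> = J (sphere_proj (\<gamma> t)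
      (ddir I (ddir I \<gamma> 1) 1 t
        + (1 / (l1 t)\<^sup>2) *\<^sub>R ((- d1 *\<^sub>R fst (\<gamma> t), 0) + real DIM('a) *\<^sub>R ((l1 t * dl1 t) *\<^sub>R ?A))
        + (1 / (l2 t)\<^sup>2) *\<^sub>R ((0, - d2 *\<^sub>R snd (\<gamma> t)) + real DIM('b) *\<^sub>R ((l2 t * dl2 t) *\<^sub>R ?A))))"
    by (simp only: linear_add[OF linear_sphere_proj] linear_scale[OF linear_sphere_proj] tang)
  also have "ddir I (ddir I \<gamma> 1) 1 t
        + (1 / (l1 t)\<^sup>2) *\<^sub>R ((- d1 *\<^sub>R fst (\<gamma> t), 0) + real DIM('a) *\<^sub>R ((l1 t * dl1 t) *\<^sub>R ?A))
        + (1 / (l2 t)\<^sup>2) *\<^sub>R ((0, - d2 *\<^sub>R snd (\<gamma> t)) + real DIM('b) *\<^sub>R ((l2 t * dl2 t) *\<^sub>R ?A))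
      = ddir I (ddir I \<gamma> 1) 1 t
        + (real DIM('a) * dl1 t / l1 t + real DIM('b) * dl2 t / l2 t) *\<^sub>R ?A
        - ((d1 / (l1 t)\<^sup>2) *\<^sub>R fst (\<gamma> t), (d2 / (l2 t)\<^sup>2) *\<^sub>R snd (\<gamma> t))"
    using pos by (cases ?A) (simp add: prod_eq_iff scaleR_add_right scaleR_add_left power2_eq_square)
  finally show ?thesis
    by (simp add: J flip: p_def)
qed

end

end

section \<open>Curves\<close>

lemma has_vector_derivative_ddir:
  assumes "f differentiable_on S" "t \<in> S"
  shows "(f has_vector_derivative ddir S f 1 t) (at t within S)"
  using has_derivative_ddir_real[OF assms] by (simp add: has_vector_derivative_def)

lemma has_real_derivative_ddir:
  assumes "f differentiable_on S" "t \<in> S"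
  shows "(f has_real_derivative ddir S f 1 t) (at t within S)"
  using has_vector_derivative_ddir[OF assms]
  by (simp add: has_real_derivative_iff_has_vector_derivative)

lemma ddir_vector:
  assumes "thick S" "t \<in> S" "(f has_vector_derivative D) (at t within S)"
  shows "ddir S f v t = v *\<^sub>R D"
  using ddir_eq[OF assms(1,2)] assms(3) unfolding has_vector_derivative_def by blast

lemma vector_derivative_eq_ddir:
  assumes "thick S" "t \<in> S" "f differentiable_on S"
  shows "vector_derivative f (at t within S) = ddir S f 1 t"
proof -
  have "(f has_vector_derivative vector_derivative f (at t within S)) (at t within S)"
    using has_vector_derivative_ddir[OF assms(3,2)] unfolding vector_derivative_def by (rule someI)
  from ddir_vector[OF assms(1,2) this, of 1] show ?thesis by simp
qed

section \<open>Smooth dependence of the warping functions\<close>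

text \<open>The two equations pull in opposite directions. If \<open>a < a'\<close>, the first
  forces \<open>b' < b\<close>; then \<open>d2 / b\<^sup>2\<close> and
  \<open>- d1 / a\<^sup>2\<close> both strictly increase on passing to the primed pair, against the
  second.\<close>

lemma warping_equations_inj:
  fixes a b a' b' d1 d2 :: real
  assumes pos: "a > 0" "b > 0" "a' > 0" "b' > 0" "d1 > 0" "d2 > 0" and mn: "m > 0" "n > 0"
    and eq: "a ^ m * b ^ n = a' ^ m * b' ^ n" "d2 / b\<^sup>2 - d1 / a\<^sup>2 = d2 / b'\<^sup>2 - d1 / a'\<^sup>2"
  shows "a = a' \<and> b = b'"
proof -
  have less: False
    if h: "a > 0" "b > 0" "a' > 0" "b' > 0" "a ^ m * b ^ n = a' ^ m * b' ^ n"
      "d2 / b\<^sup>2 - d1 / a\<^sup>2 = d2 / b'\<^sup>2 - d1 / a'\<^sup>2" "a < a'" for a b a' b' :: real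
  proof -
    have "a ^ m < a' ^ m"
      using h mn by (intro power_strict_mono) auto
    have "b' < b"
    proof (rule ccontr)
      assume "\<not> b' < b"
      then have "b ^ n \<le> b' ^ n"
        using h by (intro power_mono) auto
      then have "a ^ m * b ^ n < a' ^ m * b' ^ n"
        using \<open>a ^ m < a' ^ m\<close> h by (intro mult_less_le_imp_less) auto
      then show False using h by simp
    qed
    then have "d2 / b\<^sup>2 < d2 / b'\<^sup>2"
      using h pos by (intro divide_strict_left_mono power_strict_mono) auto
    moreover have "d1 / a'\<^sup>2 < d1 / a\<^sup>2"
      using h pos by (intro divide_strict_left_mono power_strict_mono) auto
    ultimately show False using h(6) by linarith
  qed
  have "a = a'"
    using less[of a b a' b'] less[of a' b' a b] pos eq by (metis linorder_neqE_linordered_idom)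
  moreover have "b = b'"
    using eq(1) \<open>a = a'\<close> pos mn power_eq_iff_eq_base[of n b b'] by simp
  ultimately show ?thesis ..
qed

text \<open>
  Inverse function theorem for \<open>(a, b) \<mapsto> (a ^ m * b ^ n, d2 / b\<^sup>2 - d1 / a\<^sup>2)\<close> on the positive
  quadrant: the entries of its Jacobian have signs \<open>+ + / + -\<close>, so the determinant never vanishes.
\<close>

lemma warping_functions_differentiable:
  fixes F T a b :: "real \<Rightarrow> real"
  assumes "F differentiable_on I" "T differentiable_on I"
    and pos: "\<And>t. t \<in> I \<Longrightarrow> a t > 0" "\<And>t. t \<in> I \<Longrightarrow> b t > 0" and d: "d1 > 0" "d2 > 0"
    and mn: "m > 0" "n > 0"
    and F: "\<And>t. t \<in> I \<Longrightarrow> a t ^ m * b t ^ n = F t"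
    and T: "\<And>t. t \<in> I \<Longrightarrow> d2 / (b t)\<^sup>2 - d1 / (a t)\<^sup>2 = T t"
  shows "(\<lambda>t. (a t, b t)) differentiable_on I"
proof -
  define Q :: "(real \<times> real) set" where "Q = {0<..} \<times> {0<..}"
  define \<Phi> :: "real \<times> real \<Rightarrow> real \<times> real"
    where "\<Phi> = (\<lambda>z. (fst z ^ m * snd z ^ n, d2 / (snd z)\<^sup>2 - d1 / (fst z)\<^sup>2))"
  have inj: "inj_on \<Phi> Q"
  proof (rule inj_onI)
    fix z z' assume z: "z \<in> Q" "z' \<in> Q" "\<Phi> z = \<Phi> z'"
    have "fst z = fst z' \<and> snd z = snd z'"
      by (rule warping_equations_inj[OF _ _ _ _ d mn]) (use z in \<open>auto simp: Q_def \<Phi>_def\<close>)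
    then show "z = z'"
      by (simp add: prod_eq_iff)
  qed
  have opQ: "open Q"
    by (simp add: Q_def open_Times)
  have cont: "continuous_on Q \<Phi>"
    unfolding \<Phi>_def by (intro continuous_intros) (auto simp: Q_def)
  have inv: "\<exists>D. (inv_into Q \<Phi> has_derivative D) (at (\<Phi> (x, y)))" if "x > 0" "y > 0" for x y
  proof -
    \<comment> \<open>The Jacobian at \<open>(x, y)\<close> has rows \<open>p, q\<close> and
      \<open>r, - s\<close>; \<open>D\<close> is minus its determinant, a sum of two positive
      terms.\<close>
    define p q r s where "p = of_nat m * x ^ (m - 1) * y ^ n" and "q = x ^ m * (of_nat n * y ^ (n - 1))"
      and "r = 2 * d1 / x ^ 3" and "s = 2 * d2 / y ^ 3"
    define D where "D = p * s + q * r"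
    have pqrs: "p > 0" "q > 0" "r > 0" "s > 0"
      using that mn d by (auto simp: p_def q_def r_def s_def)
    then have "D > 0"
      by (auto simp: D_def intro: add_pos_pos)
    have der: "(\<Phi> has_derivative (\<lambda>h. (p * fst h + q * snd h, r * fst h - s * snd h))) (at (x, y))"
      unfolding \<Phi>_def p_def q_def r_def s_def
    proof (rule has_derivative_Pair, goal_cases)
      case 1
      show ?case
        by (rule derivative_eq_intros refl | simp add: fun_eq_iff algebra_simps)+
    next
      case 2
      show ?case
        using that by (auto intro!: derivative_eq_intros simp: fun_eq_iff field_simps eval_nat_numeral)
    qed
    \<comment> \<open>The second map is the inverse of the Jacobian by Cramer's rule.\<close>
    have "(\<lambda>h. (p * fst h + q * snd h, r * fst h - s * snd h)) \<circ>
        (\<lambda>h. ((s * fst h + q * snd h) / D, (r * fst h - p * snd h) / D)) = id"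
    proof
      fix h :: "real \<times> real"
      have "p * ((s * fst h + q * snd h) / D) + q * ((r * fst h - p * snd h) / D) = D * fst h / D"
        unfolding D_def by (simp add: algebra_simps add_divide_distrib[symmetric] diff_divide_distrib[symmetric])
      moreover have "r * ((s * fst h + q * snd h) / D) - s * ((r * fst h - p * snd h) / D) = D * snd h / D"
        unfolding D_def by (simp add: algebra_simps add_divide_distrib[symmetric] diff_divide_distrib[symmetric])
      ultimately show "((\<lambda>h. (p * fst h + q * snd h, r * fst h - s * snd h)) \<circ>
        (\<lambda>h. ((s * fst h + q * snd h) / D, (r * fst h - p * snd h) / D))) h = id h"
        using \<open>D > 0\<close> by simp
    qed
    from has_derivative_inverse_strong[OF opQ _ cont inv_into_f_f[OF inj] der this] that
    show ?thesis by (auto simp: Q_def)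
  qed
  show ?thesis
    unfolding differentiable_on_def
  proof
    fix t assume t: "t \<in> I"
    have FT: "(F t, T t) = \<Phi> (a t, b t)" if "t \<in> I" for t
      using F[OF that] T[OF that] by (simp add: \<Phi>_def)
    obtain D where D: "(inv_into Q \<Phi> has_derivative D) (at (F t, T t))"
      using inv[OF pos(1)[OF t] pos(2)[OF t]] FT[OF t] by auto
    have "((\<lambda>t. (F t, T t)) has_derivative (\<lambda>v. (ddir I F v t, ddir I T v t))) (at t within I)"
      by (intro has_derivative_Pair has_derivative_ddir assms t)
    from has_derivative_compose[OF this D]
    have comp: "((\<lambda>t. inv_into Q \<Phi> (F t, T t)) has_derivative (\<lambda>v. D (ddir I F v t, ddir I T v t)))
        (at t within I)" .
    \<comment> \<open>Injectivity on the quadrant identifies the given pair with the inverse map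
      applied to \<open>(F t, T t)\<close>, so the chain rule supplies its derivative.\<close>
    have "(a t, b t) = inv_into Q \<Phi> (F t, T t)" if "t \<in> I" for t
      using inv_into_f_f[OF inj, of "(a t, b t)"] pos[OF that] by (simp add: FT[OF that] Q_def)
    from has_derivative_transform[OF t this comp]
    have "((\<lambda>t. (a t, b t)) has_derivative (\<lambda>v. D (ddir I F v t, ddir I T v t))) (at t within I)" .
    then show "(\<lambda>t. (a t, b t)) differentiable at t within I"
      by (auto simp: differentiable_def)
  qed
qed

text \<open>Written in logarithmic form, so that the coefficient of \<open>ddir I \<gamma> 1\<close>
  in the tension field can be recognised as the logarithmic derivative of \<open>F\<close>.\<close>

lemma power_mult_power_has_derivative:
  fixes a b :: "real \<Rightarrow> real"
  assumes "(a has_real_derivative da) (at t within I)" "(b has_real_derivative db) (at t within I)"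
    and "a t \<noteq> 0" "b t \<noteq> 0" "m > 0" "n > 0"
  shows "((\<lambda>t. a t ^ m * b t ^ n) has_real_derivative
    a t ^ m * b t ^ n * (real m * da / a t + real n * db / b t)) (at t within I)"
proof -
  have "a t ^ m = a t ^ (m - Suc 0) * a t" "b t ^ n = b t ^ (n - Suc 0) * b t"
    using assms(5,6) by (simp_all add: power_minus_mult flip: One_nat_def)
  with assms(3,4) show ?thesis
    by (auto intro!: derivative_eq_intros assms(1,2) simp: field_simps)
qed

section \<open>The change of time\<close>

text \<open>The fundamental theorem is available on a compact interval. \<open>{a..b}\<close> is
  chosen inside \<open>I\<close>, containing \<open>t\<close> and \<open>t0\<close>, with
  \<open>t\<close> as an end point only where \<open>I\<close> itself ends; near \<open>t\<close> it
  then coincides with \<open>I\<close>.\<close>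

lemma has_real_derivative_interval_integral:
  fixes f :: "real \<Rightarrow> real"
  assumes I: "is_interval I" and cont: "continuous_on I f" and t0: "t0 \<in> I" and t: "t \<in> I"
  shows "((\<lambda>u. LBINT x=t0..u. f x) has_real_derivative f t) (at t within I)"
proof -
  obtain a where a: "a \<in> I" "a \<le> t" "a \<le> t0" "a = t \<longrightarrow> (\<forall>x\<in>I. t \<le> x)"
  proof (cases "\<exists>x\<in>I. x < t")
    case True
    then obtain x where "x \<in> I" "x < t" by blast
    then show ?thesis
      using that[of "min x t0"] t0 by (auto simp: min_def split: if_splits)
  next
    case False
    then show ?thesis
      using that[of t] t t0 by (auto simp: not_less)
  qed
  obtain b where b: "b \<in> I" "t \<le> b" "t0 \<le> b" "b = t \<longrightarrow> (\<forall>x\<in>I. x \<le> t)"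
  proof (cases "\<exists>x\<in>I. x > t")
    case True
    then obtain x where "x \<in> I" "x > t" by blast
    then show ?thesis
      using that[of "max x t0"] t0 by (auto simp: max_def split: if_splits)
  next
    case False
    then show ?thesis
      using that[of t] t t0 by (auto simp: not_less)
  qed
  have ab: "{a..b} \<subseteq> I"
    using I a(1) b(1) by (meson atLeastAtMost_iff is_interval_1 subsetI)
  have "((\<lambda>u. LBINT x=t0..u. f x) has_vector_derivative f t) (at t within {a..b})"
    by (rule interval_integral_FTC2) (use a b ab cont continuous_on_subset in auto)
  moreover
  \<comment> \<open>An open interval around \<open>t\<close> on which \<open>I\<close> and
    \<open>{a..b}\<close> agree. If \<open>a = t\<close>, then \<open>t\<close> is the least point
    of \<open>I\<close> and any smaller bound will do; likewise for \<open>b\<close>.\<close>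
  define U where "U = {(if a = t then t - 1 else a)<..<(if b = t then t + 1 else b)}"
  have "at t within I = at t within {a..b}"
  proof (rule at_within_nhd)
    show "t \<in> U" "open U"
      using a b by (auto simp: U_def)
    show "I \<inter> U - {t} = {a..b} \<inter> U - {t}"
      using a b ab by (auto simp: U_def split: if_splits intro: order_antisym)
  qed
  ultimately show ?thesis
    by (simp add: has_real_derivative_iff_has_vector_derivative)
qed

lemma strict_mono_on_of_derivative_pos:
  fixes f :: "real \<Rightarrow> real"
  assumes I: "is_interval I"
    and f: "\<And>t. t \<in> I \<Longrightarrow> (f has_real_derivative f' t) (at t within I)"
    and pos: "\<And>t. t \<in> I \<Longrightarrow> f' t > 0"
  shows "strict_mono_on I f"
proof (rule strict_mono_onI)
  fix r s assume rs: "r \<in> I" "s \<in> I" "r < s"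
  have sub: "{r..s} \<subseteq> I"
    using I rs(1,2) by (meson atLeastAtMost_iff is_interval_1 subsetI)
  show "f r < f s"
  proof (rule DERIV_pos_imp_increasing_open[OF rs(3)])
    fix x assume x: "r < x" "x < s"
    then have "x \<in> I" using sub by auto
    \<comment> \<open>Passing to the open interval \<open>{r<..<s}\<close> turns the derivative
      within \<open>I\<close> into a two-sided one.\<close>
    then have "(f has_real_derivative f' x) (at x within {r<..<s})"
      using sub by (intro has_field_derivative_subset[OF f]) auto
    then have "(f has_real_derivative f' x) (at x)"
      using x by (simp add: at_within_open[of x "{r<..<s}"])
    then show "\<exists>y. (f has_real_derivative y) (at x) \<and> 0 < y"
      using pos \<open>x \<in> I\<close> by blast
  next
    have "continuous_on I f"
      by (rule DERIV_continuous_on[OF f])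
    then show "continuous_on {r..s} f"
      using sub continuous_on_subset by blast
  qed
qed

text \<open>The difference quotient of \<open>g\<close> at \<open>f t\<close> is the reciprocal of
  that of \<open>f\<close> at \<open>t\<close>, evaluated at \<open>g y\<close>; continuity of
  \<open>g\<close> sends \<open>g y\<close> to \<open>t\<close>. The argument also covers end
  points, where the derivatives are one-sided.\<close>

lemma has_real_derivative_inverse_within:
  fixes f g :: "real \<Rightarrow> real"
  assumes f: "(f has_real_derivative D) (at t within I)" and D: "D \<noteq> 0" and t: "t \<in> I"
    and g: "\<And>t. t \<in> I \<Longrightarrow> g (f t) = t" and cont: "continuous_on (f ` I) g"
  shows "(g has_real_derivative inverse D) (at (f t) within f ` I)"
proof -
  have lim: "filterlim g (at t within I) (at (f t) within f ` I)"
    unfolding filterlim_at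
  proof
    show "\<forall>\<^sub>F y in at (f t) within f ` I. g y \<in> I \<and> g y \<noteq> t"
      unfolding eventually_at_filter by (rule always_eventually) (use g in auto)
    show "(g \<longlongrightarrow> t) (at (f t) within f ` I)"
      using cont t g[OF t] unfolding continuous_on_def by force
  qed
  have "((\<lambda>x. (f x - f t) / (x - t)) \<longlongrightarrow> D) (at t within I)"
    using f by (simp add: has_field_derivative_iff)
  from tendsto_inverse[OF filterlim_compose[OF this lim] D]
  have "((\<lambda>y. inverse ((f (g y) - f t) / (g y - t))) \<longlongrightarrow> inverse D) (at (f t) within f ` I)" .
  then show ?thesis
    unfolding has_field_derivative_iff
    by (rule Lim_transform_eventually)
      (auto simp: eventually_at_filter g t intro!: always_eventually)
qed

locale time_change =
  fixes I :: "real set" and F \<tau> :: "real \<Rightarrow> real"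
  assumes interval: "is_interval I" and thick_I: "thick I" and smooth_F: "smooth_on I F"
    and F_pos: "\<And>t. t \<in> I \<Longrightarrow> F t > 0"
    and \<tau>: "\<And>t. t \<in> I \<Longrightarrow> (\<tau> has_real_derivative 1 / F t) (at t within I)"
begin

abbreviation "J \<equiv> \<tau> ` I"

definition \<sigma> :: "real \<Rightarrow> real" where "\<sigma> = inv_into I \<tau>"

lemma strict_mono_\<tau>: "strict_mono_on I \<tau>"
  using F_pos by (intro strict_mono_on_of_derivative_pos[OF interval \<tau>]) auto

lemma inj_\<tau>: "inj_on \<tau> I"
  by (rule strict_mono_on_imp_inj_on[OF strict_mono_\<tau>])

lemma \<sigma>_\<tau>: "t \<in> I \<Longrightarrow> \<sigma> (\<tau> t) = t"
  using inj_\<tau> by (simp add: \<sigma>_def)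

lemma \<sigma>_mem: "s \<in> J \<Longrightarrow> \<sigma> s \<in> I"
  using \<sigma>_\<tau> by auto

lemma continuous_on_\<tau>: "continuous_on I \<tau>"
  by (rule DERIV_continuous_on[OF \<tau>])

text \<open>A continuous injection of an interval into the line is a homeomorphism onto its image,
  and \<open>\<sigma>\<close> agrees with its inverse there.\<close>

lemma continuous_on_\<sigma>: "continuous_on J \<sigma>"
proof -
  obtain h where h: "homeomorphism I J \<tau> h"
    using homeomorphism_into_1d[OF is_interval_path_connected[OF interval] continuous_on_\<tau> refl inj_\<tau>]
    by blast
  then have "\<sigma> s = h s" if "s \<in> J" for s
    using that \<sigma>_\<tau> by (auto simp: homeomorphism_def)
  with h show ?thesis
    using continuous_on_cong unfolding homeomorphism_def by metis
qed

lemma has_derivative_\<sigma>: "s \<in> J \<Longrightarrow> (\<sigma> has_real_derivative F (\<sigma> s)) (at s within J)"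
  using has_real_derivative_inverse_within[OF \<tau>, where g = \<sigma>] F_pos \<sigma>_\<tau> continuous_on_\<sigma>
  by fastforce

text \<open>The image is an interval by connectedness, and injectivity of \<open>\<tau>\<close>
  provides two distinct points in it.\<close>

lemma thick_J: "thick J"
proof (cases "I = {}")
  case True
  then show ?thesis by (simp add: thick_def)
next
  case False
  then obtain a where a: "a \<in> I" by blast
  then obtain d where d: "d \<noteq> 0" "a + d \<in> I"
    using thick_I unfolding thick_def by (metis Basis_real_def abs_0 insertI1 mult.right_neutral
        order_less_irrefl real_scaleR_def zero_less_one)
  have int: "is_interval J"
    using interval continuous_on_\<tau> by (simp add: connected_continuous_image is_interval_connected_1)
  have "\<tau> a \<noteq> \<tau> (a + d)"
    using inj_\<tau> a d by (auto dest: inj_onD)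
  then show ?thesis
    using a d thick_interval[OF int, of "\<tau> a" "\<tau> (a + d)"]
      thick_interval[OF int, of "\<tau> (a + d)" "\<tau> a"] by fastforce
qed

lemma has_vector_derivative_comp_\<sigma>:
  assumes h: "h differentiable_on I" and s: "s \<in> J"
  shows "((\<lambda>s. h (\<sigma> s)) has_vector_derivative F (\<sigma> s) *\<^sub>R ddir I h 1 (\<sigma> s)) (at s within J)"
proof -
  have "((\<lambda>s. h (\<sigma> s)) has_derivative (\<lambda>v. (F (\<sigma> s) * v) *\<^sub>R ddir I h 1 (\<sigma> s))) (at s within J)"
    by (rule has_derivative_in_compose2[where t = I and g' = "\<lambda>t v. v *\<^sub>R ddir I h 1 t"])
      (use s has_derivative_ddir_real[OF h] has_derivative_\<sigma> \<sigma>_mem in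
        \<open>auto simp: has_field_derivative_def\<close>)
  then show ?thesis
    by (simp add: has_vector_derivative_def mult.commute)
qed

lemma ddir_comp_\<sigma>:
  assumes "h differentiable_on I" "s \<in> J"
  shows "ddir J (\<lambda>s. h (\<sigma> s)) v s = v *\<^sub>R F (\<sigma> s) *\<^sub>R ddir I h 1 (\<sigma> s)"
  by (rule ddir_vector[OF thick_J assms(2) has_vector_derivative_comp_\<sigma>[OF assms]])

lemma comp_\<sigma>_differentiable_on:
  assumes "h differentiable_on I"
  shows "(\<lambda>s. h (\<sigma> s)) differentiable_on J"
  using has_vector_derivative_comp_\<sigma>[OF assms]
  unfolding differentiable_on_def has_vector_derivative_def differentiable_def by blast

text \<open>The derivative of \<open>h \<circ> \<sigma>\<close> is again a smooth function on
  \<open>I\<close>, namely a multiple of \<open>F\<close> times the derivative of \<open>h\<close>,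
  composed with \<open>\<sigma>\<close>. The induction over all \<open>h\<close> thus uses only the
  first derivative of \<open>\<sigma>\<close>, expressed by \<open>F\<close>.\<close>

lemma smooth_on_comp_\<sigma>:
  assumes "smooth_on I h"
  shows "smooth_on J (\<lambda>s. h (\<sigma> s))"
  unfolding smooth_on_def
proof
  fix k
  show "Ck_on k J (\<lambda>s. h (\<sigma> s))"
    using assms
  proof (induction k arbitrary: h)
    case 0
    then have "continuous_on I h"
      by (intro differentiable_imp_continuous_on smooth_on_imp_differentiable_on)
    then show ?case
      unfolding Ck_on.simps
      by (rule continuous_on_compose2[OF _ continuous_on_\<sigma>]) (use \<sigma>_mem in blast)
  next
    case (Suc k)
    note d = smooth_on_imp_differentiable_on[OF Suc.prems]
    have "smooth_on I (\<lambda>t. v *\<^sub>R F t *\<^sub>R ddir I h 1 t)" for v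
      by (intro smooth_on_scaleR smooth_on_const thick_I smooth_F smooth_on_ddir Suc.prems)
    note IH = Suc.IH[OF this]
    have "Ck_on k J (ddir J (\<lambda>s. h (\<sigma> s)) v)" for v
      using IH[of v] by (subst Ck_on_cong[of J]) (rule ddir_comp_\<sigma>[OF d], assumption)
    then show ?case
      using comp_\<sigma>_differentiable_on[OF d] by simp
  qed
qed

text \<open>Neumann's equation pulled back to \<open>I\<close> by \<open>\<tau>\<close>: the
  acceleration becomes F (F \<gamma>')'. Since \<Gamma> is an arbitrary map with \<gamma> = \<Gamma>
  \<circ> \<tau>, the lemma serves both directions of the theorem.\<close>

lemma neumann_solution_iff:
  assumes \<gamma>: "smooth_on I \<gamma>" "\<gamma> ` I \<subseteq> sphere 0 1" and \<Gamma>: "\<And>t. t \<in> I \<Longrightarrow> \<gamma> t = \<Gamma> (\<tau> t)"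
  shows "neumann_solution \<kappa> J \<Gamma> \<longleftrightarrow> (\<forall>t\<in>I. sphere_proj (\<gamma> t)
      ((F t)\<^sup>2 *\<^sub>R ddir I (ddir I \<gamma> 1) 1 t + (F t * ddir I F 1 t) *\<^sub>R ddir I \<gamma> 1 t
        - \<kappa> *\<^sub>R (0, snd (\<gamma> t))) = 0)"
proof -
  note d\<gamma> = smooth_on_imp_differentiable_on[OF \<gamma>(1)]
    smooth_on_imp_differentiable_on[OF smooth_on_ddir[OF \<gamma>(1), of 1]]
  note dF = smooth_on_imp_differentiable_on[OF smooth_F]
  have \<Gamma>_eq: "\<Gamma> s = \<gamma> (\<sigma> s)" if "s \<in> J" for s
    using that \<Gamma> \<sigma>_\<tau> by auto
  have smooth: "smooth_on J \<Gamma>"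
    by (rule iffD2[OF smooth_on_cong[OF \<Gamma>_eq] smooth_on_comp_\<sigma>[OF \<gamma>(1)]])
  have d\<Gamma>: "\<Gamma> differentiable_on J"
    using smooth by (rule smooth_on_imp_differentiable_on)
  \<comment> \<open>The \<tau>-velocity of \<Gamma> as a function of \<open>t\<close>, obtained from
    d/d\<tau> = F d/dt.\<close>
  define W where "W = (\<lambda>t. F t *\<^sub>R ddir I \<gamma> 1 t)"
  have vel: "velocity J \<Gamma> s = W (\<sigma> s)" if "s \<in> J" for s
  proof -
    have "velocity J \<Gamma> s = ddir J \<Gamma> 1 s"
      unfolding velocity_def by (rule vector_derivative_eq_ddir[OF thick_J that d\<Gamma>])
    also have "\<dots> = ddir J (\<lambda>s. \<gamma> (\<sigma> s)) 1 s"
      by (rule ddir_cong[OF \<Gamma>_eq that])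
    also have "\<dots> = W (\<sigma> s)"
      using ddir_comp_\<sigma>[OF d\<gamma>(1) that, of 1] by (simp add: W_def)
    finally show ?thesis .
  qed
  have DW: "(W has_vector_derivative (F t *\<^sub>R ddir I (ddir I \<gamma> 1) 1 t + ddir I F 1 t *\<^sub>R ddir I \<gamma> 1 t))
      (at t within I)" if "t \<in> I" for t
    unfolding W_def
    by (intro has_vector_derivative_scaleR has_real_derivative_ddir has_vector_derivative_ddir dF d\<gamma> that)
  then have dW: "W differentiable_on I"
    unfolding differentiable_on_def has_vector_derivative_def differentiable_def by blast
  have dvel: "velocity J \<Gamma> differentiable_on J"
    by (rule iffD2[OF differentiable_on_cong[OF vel] comp_\<sigma>_differentiable_on[OF dW]])
  have acc: "vector_derivative (velocity J \<Gamma>) (at (\<tau> t) within J)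
      = (F t)\<^sup>2 *\<^sub>R ddir I (ddir I \<gamma> 1) 1 t + (F t * ddir I F 1 t) *\<^sub>R ddir I \<gamma> 1 t"
    if t: "t \<in> I" for t
  proof -
    have "vector_derivative (velocity J \<Gamma>) (at (\<tau> t) within J) = ddir J (velocity J \<Gamma>) 1 (\<tau> t)"
      using t by (intro vector_derivative_eq_ddir thick_J dvel) auto
    also have "\<dots> = ddir J (\<lambda>s. W (\<sigma> s)) 1 (\<tau> t)"
      using t vel by (intro ddir_cong) auto
    also have "\<dots> = F t *\<^sub>R ddir I W 1 t"
      using t ddir_comp_\<sigma>[OF dW, of "\<tau> t" 1] by (simp add: \<sigma>_\<tau>)
    also have "ddir I W 1 t = F t *\<^sub>R ddir I (ddir I \<gamma> 1) 1 t + ddir I F 1 t *\<^sub>R ddir I \<gamma> 1 t"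
      using ddir_vector[OF thick_I t DW[OF t], of 1] by simp
    finally show ?thesis
      by (simp add: scaleR_add_right power2_eq_square)
  qed
  have "sphere_cov_deriv J \<Gamma> (velocity J \<Gamma>) (\<tau> t) = \<kappa> *\<^sub>R sphere_grad neumann_U (\<Gamma> (\<tau> t))
      \<longleftrightarrow> sphere_proj (\<gamma> t) ((F t)\<^sup>2 *\<^sub>R ddir I (ddir I \<gamma> 1) 1 t
        + (F t * ddir I F 1 t) *\<^sub>R ddir I \<gamma> 1 t - \<kappa> *\<^sub>R (0, snd (\<gamma> t))) = 0" if t: "t \<in> I" for t
  proof -
    have "norm (\<gamma> t) = 1" using \<gamma>(2) t by auto
    then have grad: "sphere_grad neumann_U (\<gamma> t) = sphere_proj (\<gamma> t) (0, snd (\<gamma> t))"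
      by (rule sphere_grad_eq[OF _ neumann_U_has_derivative])
    show ?thesis
      unfolding sphere_cov_deriv_def acc[OF t] \<Gamma>[OF t, symmetric] grad
      by (subst linear_diff[OF linear_sphere_proj])
        (simp only: linear_scale[OF linear_sphere_proj] right_minus_eq)
  qed
  moreover have "\<Gamma> ` J \<subseteq> sphere 0 1"
    using \<gamma>(2) \<Gamma> by auto
  ultimately show ?thesis
    using smooth by (simp add: neumann_solution_def)
qed

end

section \<open>Charts\<close>

lemma riemannian_manifold_chart:
  assumes M: "riemannian_manifold M" and i: "i \<in> charts M"
  shows "open (cimg M i)" "inj_on (coord M i) (cdom M i)" "cdom M i \<subseteq> topspace (topo M)"
    and "x \<in> cimg M i \<Longrightarrow> is_inner (met M i x)"
    and "smooth_on (cimg M i) (\<lambda>x. met M i x u v)"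
proof -
  have chart: "openin (topo M) (cdom M i) \<and> open (cimg M i) \<and>
      homeomorphic_map (subtopology (topo M) (cdom M i)) (top_of_set (cimg M i)) (coord M i)"
    using M i unfolding riemannian_manifold_def by blast
  then show sub: "cdom M i \<subseteq> topspace (topo M)" and "open (cimg M i)"
    by (auto dest: openin_subset)
  show "inj_on (coord M i) (cdom M i)"
    using chart homeomorphic_imp_injective_map[of "subtopology (topo M) (cdom M i)"] sub
    by (auto simp: inf.absorb2)
  show "x \<in> cimg M i \<Longrightarrow> is_inner (met M i x)"
    using M i unfolding riemannian_manifold_def is_inner_def by blast
  show "smooth_on (cimg M i) (\<lambda>x. met M i x u v)"
    using M i unfolding riemannian_manifold_def by blast
qed

lemma riemannian_manifold_ex_chart:
  assumes "riemannian_manifold M"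
  shows "\<exists>i p. i \<in> charts M \<and> p \<in> cdom M i"
proof -
  have "topspace (topo M) \<noteq> {}" "(\<Union>i\<in>charts M. cdom M i) = topspace (topo M)"
    using assms by (simp_all add: riemannian_manifold_def)
  then show ?thesis by blast
qed

lemma norm_eigenmap: "eigenmap M f d \<Longrightarrow> p \<in> topspace (topo M) \<Longrightarrow> norm (f p) = 1"
  by (simp add: eigenmap_def image_subset_iff)

lemma eigenmap_chart:
  assumes M: "riemannian_manifold M" and f: "eigenmap M f d" and i: "i \<in> charts M"
  shows "smooth_on (cimg M i) (f \<circ> cinv M i)"
    and "x \<in> cimg M i \<Longrightarrow> norm ((f \<circ> cinv M i) x) = 1"
    and "x \<in> cimg M i \<Longrightarrow>
      coord_laplacian (cimg M i) (met M i) (f \<circ> cinv M i) x = - (d *\<^sub>R (f \<circ> cinv M i) x)"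
proof -
  show "smooth_on (cimg M i) (f \<circ> cinv M i)"
    using f i by (auto simp: eigenmap_def smooth_map_def)
  assume x: "x \<in> cimg M i"
  then have p: "cinv M i x \<in> cdom M i" "coord M i (cinv M i x) = x"
    unfolding cimg_def cinv_def by (auto intro: inv_into_into f_inv_into_f)
  then show "norm ((f \<circ> cinv M i) x) = 1"
    using riemannian_manifold_chart(3)[OF M i] by (auto intro: norm_eigenmap[OF f])
  have "laplacian_at M i f (cinv M i x) = - (d *\<^sub>R f (cinv M i x))"
    using f i p by (auto simp: eigenmap_def)
  then show "coord_laplacian (cimg M i) (met M i) (f \<circ> cinv M i) x = - (d *\<^sub>R (f \<circ> cinv M i) x)"
    using p by (simp add: laplacian_at_def)
qed

text \<open>\<open>inv_into\<close> is unspecified off the chart image, so the coordinate expression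
  of the product map is known only on \<open>S\<close>. That suffices because every derivative in
  the tension field is taken within \<open>S\<close>.\<close>

lemma coord_tension_cong:
  assumes eq: "\<And>y. y \<in> S \<Longrightarrow> f y = h y" and x: "x \<in> S"
  shows "coord_tension S g f x = coord_tension S g h x"
proof -
  have "ddir S f v y = ddir S h v y" if "y \<in> S" for v y
    using eq that by (rule ddir_cong)
  then have "ddir S (ddir S f v) u x = ddir S (ddir S h v) u x" for u v
    using x by (rule ddir_cong)
  then show ?thesis
    using ddir_cong[OF eq x] eq[OF x] by (simp add: coord_tension_def)
qed

lemma warped_product_chart:
  assumes M: "riemannian_manifold M1" "riemannian_manifold M2"
    and W_def: "W = warped_product I l1 l2 M1 M2" and ij: "i \<in> charts M1" "j \<in> charts M2"
  shows "cdom W (i, j) = I \<times> cdom M1 i \<times> cdom M2 j"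
    and "coord W (i, j) (t, p, q) = (t, coord M1 i p, coord M2 j q)"
    and "cimg W (i, j) = I \<times> cimg M1 i \<times> cimg M2 j"
    and "met W (i, j) = warped_metric l1 l2 (met M1 i) (met M2 j)"
    and "w \<in> cimg W (i, j) \<Longrightarrow> (product_map \<gamma> f1 f2 \<circ> cinv W (i, j)) w
      = product_map \<gamma> (f1 \<circ> cinv M1 i) (f2 \<circ> cinv M2 j) w"
proof -
  show dom: "cdom W (i, j) = I \<times> cdom M1 i \<times> cdom M2 j"
    and coord: "coord W (i, j) (t, p, q) = (t, coord M1 i p, coord M2 j q)"
    and "met W (i, j) = warped_metric l1 l2 (met M1 i) (met M2 j)" for t p q
    by (auto simp: W_def warped_product_def warped_metric_def)
  show img: "cimg W (i, j) = I \<times> cimg M1 i \<times> cimg M2 j"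
    by (force simp: cimg_def dom coord)
  \<comment> \<open>With injectivity, the chosen inverse of the product coordinates splits into the
    chosen inverses of the factors.\<close>
  have inj: "inj_on (coord W (i, j)) (cdom W (i, j))"
    using riemannian_manifold_chart(2)[OF M(1) ij(1)] riemannian_manifold_chart(2)[OF M(2) ij(2)]
    by (auto simp: inj_on_def dom coord)
  assume w: "w \<in> cimg W (i, j)"
  obtain t x y where txy: "w = (t, x, y)" by (metis surj_pair)
  have mem: "t \<in> I" "x \<in> cimg M1 i" "y \<in> cimg M2 j"
    using w txy img by auto
  have "cinv M1 i x \<in> cdom M1 i" "coord M1 i (cinv M1 i x) = x"
    "cinv M2 j y \<in> cdom M2 j" "coord M2 j (cinv M2 j y) = y"
    using mem(2,3) unfolding cimg_def cinv_def by (auto intro: inv_into_into f_inv_into_f)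
  then have "cinv W (i, j) w = (t, cinv M1 i x, cinv M2 j y)"
    unfolding cinv_def[of W] using mem inj by (intro inv_into_f_eq) (auto simp: dom coord txy)
  then show "(product_map \<gamma> f1 f2 \<circ> cinv W (i, j)) w
      = product_map \<gamma> (f1 \<circ> cinv M1 i) (f2 \<circ> cinv M2 j) w"
    by (simp add: txy product_map_apply)
qed

lemma product_map_eq_0_iff:
  fixes f1 :: "'m1 \<Rightarrow> complex^'n1" and f2 :: "'m2 \<Rightarrow> complex^'n2"
  assumes "norm (f1 p) = 1" "norm (f2 q) = 1"
  shows "product_map c f1 f2 (t, p, q) = 0 \<longleftrightarrow> c t = 0"
  using norm_product_map[of f1 p f2 q c t] assms by (metis norm_eq_zero)

text \<open>At \<open>(t, p, q)\<close> the tension field is the isometric image of a vector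
  depending on \<open>t\<close> alone, and every product chart contains all of \<open>I\<close>. The
  points of the factors therefore drop out of the condition.\<close>

lemma harmonic_product_map_iff:
  fixes M1 :: "('i1, 'm1, 'e1::euclidean_space) rmfd" and M2 :: "('i2, 'm2, 'e2::euclidean_space) rmfd"
    and f1 :: "'m1 \<Rightarrow> complex^'n1" and f2 :: "'m2 \<Rightarrow> complex^'n2"
  assumes M1: "riemannian_manifold M1" and M2: "riemannian_manifold M2"
    and f1: "eigenmap M1 f1 d1" and f2: "eigenmap M2 f2 d2" and I: "thick I"
    and l1: "\<And>t. t \<in> I \<Longrightarrow> l1 t > 0"
      "\<And>t. t \<in> I \<Longrightarrow> (l1 has_real_derivative dl1 t) (at t within I)"
    and l2: "\<And>t. t \<in> I \<Longrightarrow> l2 t > 0"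
      "\<And>t. t \<in> I \<Longrightarrow> (l2 has_real_derivative dl2 t) (at t within I)"
    and \<gamma>: "smooth_on I \<gamma>" "\<gamma> ` I \<subseteq> sphere 0 1"
  shows "harmonic_into_sphere (warped_product I l1 l2 M1 M2) (product_map \<gamma> f1 f2) \<longleftrightarrow>
    (\<forall>t\<in>I. sphere_proj (\<gamma> t) (ddir I (ddir I \<gamma> 1) 1 t
      + (real DIM('e1) * dl1 t / l1 t + real DIM('e2) * dl2 t / l2 t) *\<^sub>R ddir I \<gamma> 1 t
      - ((d1 / (l1 t)\<^sup>2) *\<^sub>R fst (\<gamma> t), (d2 / (l2 t)\<^sup>2) *\<^sub>R snd (\<gamma> t))) = 0)"
    (is "_ \<longleftrightarrow> (\<forall>t\<in>I. ?E t = 0)")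
proof -
  let ?W = "warped_product I l1 l2 M1 M2" and ?G = "product_map \<gamma> f1 f2"
  have norm\<gamma>: "norm (\<gamma> t) = 1" if "t \<in> I" for t
    using \<gamma>(2) that by auto
  have charts: "charts ?W = charts M1 \<times> charts M2"
    by (simp add: warped_product_def)
  note chart = warped_product_chart[OF M1 M2 refl, where I = I and ?l1.0 = l1 and ?l2.0 = l2]
  have chart_locale: "warped_chart I (cimg M1 i) (cimg M2 j) l1 l2 dl1 dl2 (met M1 i) (met M2 j)"
    if "i \<in> charts M1" "j \<in> charts M2" for i j
    using that I l1 l2 riemannian_manifold_chart(1,4,5)[OF M1] riemannian_manifold_chart(1,4,5)[OF M2]
    by unfold_locales (auto intro: smooth_on_imp_differentiable_on)
  have smooth: "smooth_map ?W ?G"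
    unfolding smooth_map_def charts
  proof (clarify)
    fix i j assume ij: "i \<in> charts M1" "j \<in> charts M2"
    interpret warped_chart I "cimg M1 i" "cimg M2 j" l1 l2 dl1 dl2 "met M1 i" "met M2 j"
      by (rule chart_locale[OF ij])
    have "smooth_on (I \<times> cimg M1 i \<times> cimg M2 j) (product_map \<gamma> (f1 \<circ> cinv M1 i) (f2 \<circ> cinv M2 j))"
      using \<gamma>(1) eigenmap_chart(1)[OF M1 f1 ij(1)] eigenmap_chart(1)[OF M2 f2 ij(2)]
      unfolding smooth_on_def by (blast intro: Ck_on_product_map[OF thick_S thick_U1 thick_U2])
    then show "smooth_on (cimg ?W (i, j)) (?G \<circ> cinv ?W (i, j))"
      unfolding chart(3)[OF ij]
      by (rule iffD2[OF smooth_on_cong[OF chart(5)[OF ij, unfolded chart(3)[OF ij]]], rotated])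
  qed
  have sphere: "?G ` topspace (topo ?W) \<subseteq> sphere 0 1"
    by (auto simp: warped_product_def norm_product_map norm\<gamma> norm_eigenmap[OF f1] norm_eigenmap[OF f2])
  have tension: "tension_at ?W (i, j) ?G (t, p, q) = 0 \<longleftrightarrow> ?E t = 0"
    if ij: "i \<in> charts M1" "j \<in> charts M2" and w: "t \<in> I" "p \<in> cdom M1 i" "q \<in> cdom M2 j"
    for i j t p q
  proof -
    interpret warped_chart I "cimg M1 i" "cimg M2 j" l1 l2 dl1 dl2 "met M1 i" "met M2 j"
      by (rule chart_locale[OF ij])
    let ?x = "coord M1 i p" and ?y = "coord M2 j q"
    have xy: "?x \<in> cimg M1 i" "?y \<in> cimg M2 j"
      using w by (auto simp: cimg_def)
    have "tension_at ?W (i, j) ?G (t, p, q)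
        = coord_tension S g (product_map \<gamma> (f1 \<circ> cinv M1 i) (f2 \<circ> cinv M2 j)) (t, ?x, ?y)"
      unfolding tension_at_def chart(2-4)[OF ij]
    proof (rule coord_tension_cong)
      show "(t, ?x, ?y) \<in> S"
        using w xy by simp
    qed (rule chart(5)[OF ij, unfolded chart(3)[OF ij]])
    also have "\<dots> = product_map ?E (f1 \<circ> cinv M1 i) (f2 \<circ> cinv M2 j) (t, ?x, ?y)"
      by (rule coord_tension_product_map[OF \<gamma>(1) norm\<gamma> eigenmap_chart[OF M1 f1 ij(1)]
            eigenmap_chart[OF M2 f2 ij(2)] w(1) xy])
    finally show ?thesis
      by (simp only: product_map_eq_0_iff eigenmap_chart(2)[OF M1 f1 ij(1) xy(1)]
            eigenmap_chart(2)[OF M2 f2 ij(2) xy(2)])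
  qed
  \<comment> \<open>Manifolds are nonempty, and one point of each factor recovers the condition at
    every \<open>t\<close>.\<close>
  obtain i j p q where ne: "i \<in> charts M1" "p \<in> cdom M1 i" "j \<in> charts M2" "q \<in> cdom M2 j"
    using riemannian_manifold_ex_chart[OF M1] riemannian_manifold_ex_chart[OF M2] by blast
  have "(\<forall>k\<in>charts ?W. \<forall>w\<in>cdom ?W k. tension_at ?W k ?G w = 0) \<longleftrightarrow> (\<forall>t\<in>I. ?E t = 0)"
  proof
    assume "\<forall>k\<in>charts ?W. \<forall>w\<in>cdom ?W k. tension_at ?W k ?G w = 0"
    then have "tension_at ?W (i, j) ?G (t, p, q) = 0" if "t \<in> I" for t
      using ne that by (simp add: charts chart(1))
    then show "\<forall>t\<in>I. ?E t = 0"
      using tension ne by blast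
  next
    assume E: "\<forall>t\<in>I. ?E t = 0"
    show "\<forall>k\<in>charts ?W. \<forall>w\<in>cdom ?W k. tension_at ?W k ?G w = 0"
    proof (intro ballI)
      fix k w assume k: "k \<in> charts ?W" and w: "w \<in> cdom ?W k"
      obtain i j t p q where kw: "k = (i, j)" "w = (t, p, q)"
        by (metis surj_pair)
      then have ij: "i \<in> charts M1" "j \<in> charts M2"
        using k by (auto simp: charts)
      then have "t \<in> I" "p \<in> cdom M1 i" "q \<in> cdom M2 j"
        using w by (auto simp: kw chart(1))
      then show "tension_at ?W k ?G w = 0"
        using tension[OF ij] E unfolding kw by blast
    qed
  qed
  then show ?thesis
    using smooth sphere by (simp only: harmonic_into_sphere_def simp_thms)
qed

section \<open>Harmonicity and the Neumann equation\<close>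

theorem theorem6p1:
  fixes M1 :: "('i1, 'm1, 'e1::euclidean_space) rmfd"
    and M2 :: "('i2, 'm2, 'e2::euclidean_space) rmfd"
    and f1 :: "'m1 \<Rightarrow> complex^'n1" and f2 :: "'m2 \<Rightarrow> complex^'n2"
    and d1 d2 \<kappa> t0 :: real and I :: "real set"
    and F T \<tau> l1 l2 :: "real \<Rightarrow> real"
    and \<gamma> :: "real \<Rightarrow> complex \<times> complex"
  assumes "riemannian_manifold M1" and "riemannian_manifold M2"
    and "eigenmap M1 f1 d1" and "eigenmap M2 f2 d2"
    and "is_interval I" and "interior I \<noteq> {}" and "t0 \<in> I"
    and "smooth_on I F" and "\<And>t. t \<in> I \<Longrightarrow> F t > 0"
    and "\<And>t. t \<in> I \<Longrightarrow> T t = \<kappa> / (F t)\<^sup>2"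
    and "\<And>t. t \<in> I \<Longrightarrow> \<tau> t = (LBINT \<xi>=t0..t. 1 / F \<xi>)"
    and "\<And>t. t \<in> I \<Longrightarrow> l1 t > 0" and "\<And>t. t \<in> I \<Longrightarrow> l2 t > 0"
    and "\<And>t. t \<in> I \<Longrightarrow> l1 t ^ DIM('e1) * l2 t ^ DIM('e2) = F t"
    and "\<And>t. t \<in> I \<Longrightarrow> d2 / (l2 t)\<^sup>2 - d1 / (l1 t)\<^sup>2 = T t"
    and "smooth_on I \<gamma>" and "\<gamma> ` I \<subseteq> sphere 0 1"
  shows "harmonic_into_sphere (warped_product I l1 l2 M1 M2) (product_map \<gamma> f1 f2)
     \<longleftrightarrow> (\<exists>\<Gamma>. neumann_solution \<kappa> (\<tau> ` I) \<Gamma> \<and> (\<forall>t\<in>I. \<gamma> t = \<Gamma> (\<tau> t)))"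
proof -
  note M = assms(1-4) and int = assms(5) and t0 = assms(7) and smooth_F = assms(8)
    and F_pos = assms(9) and T = assms(10) and \<tau> = assms(11) and l_pos = assms(12,13)
    and F_eq = assms(14) and T_eq = assms(15) and \<gamma> = assms(16,17)
  have thick: "thick I"
  proof -
    obtain x e where "e > 0" "ball x e \<subseteq> I"
      using assms(6) by (meson equals0I mem_interior)
    then show ?thesis
      by (intro thick_interval[OF int, of x "x + e / 2"]) (auto simp: dist_real_def)
  qed
  note dF = smooth_on_imp_differentiable_on[OF smooth_F]
  have "(\<lambda>t. \<kappa> / (F t)\<^sup>2) differentiable_on I"
    using dF F_pos unfolding differentiable_on_def
    by (auto intro!: differentiable_divide differentiable_power simp: less_imp_neq[symmetric])
  then have dT: "T differentiable_on I"
    by (rule iffD2[OF differentiable_on_cong[OF T], rotated])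
  have d: "d1 > 0" "d2 > 0"
    using M by (auto simp: eigenmap_def)
  \<comment> \<open>Regularity of the warping functions is read off from that of \<open>F\<close>
    and \<open>T\<close>.\<close>
  have dl: "(\<lambda>t. (l1 t, l2 t)) differentiable_on I"
    by (rule warping_functions_differentiable[OF dF dT l_pos d DIM_positive DIM_positive F_eq T_eq])
  have "l1 differentiable_on I"
    using has_derivative_fst[OF has_derivative_ddir[OF dl]]
    unfolding fst_conv differentiable_on_def differentiable_def by blast
  note dl1 = has_real_derivative_ddir[OF this]
  have "l2 differentiable_on I"
    using has_derivative_snd[OF has_derivative_ddir[OF dl]]
    unfolding snd_conv differentiable_on_def differentiable_def by blast
  note dl2 = has_real_derivative_ddir[OF this]
  have log_deriv: "real DIM('e1) * ddir I l1 1 t / l1 t + real DIM('e2) * ddir I l2 1 t / l2 t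
      = ddir I F 1 t / F t" if t: "t \<in> I" for t
  proof -
    let ?D = "F t * (real DIM('e1) * ddir I l1 1 t / l1 t + real DIM('e2) * ddir I l2 1 t / l2 t)"
    have "((\<lambda>t. l1 t ^ DIM('e1) * l2 t ^ DIM('e2)) has_real_derivative ?D) (at t within I)"
      unfolding F_eq[OF t, symmetric]
      using l_pos[OF t] by (intro power_mult_power_has_derivative dl1 dl2 t DIM_positive) auto
    then have "(F has_real_derivative ?D) (at t within I)"
      unfolding has_field_derivative_def
      by (rule has_derivative_transform[OF t F_eq[symmetric], rotated])
    then have "ddir I F 1 t = ?D"
      using ddir_vector[OF thick t, of F ?D 1]
      by (simp add: has_real_derivative_iff_has_vector_derivative)
    then show ?thesis
      using F_pos[OF t] by simp
  qed
  have d\<tau>: "(\<tau> has_real_derivative 1 / F t) (at t within I)" if t: "t \<in> I" for t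
  proof -
    have "continuous_on I (\<lambda>t. 1 / F t)"
      using F_pos differentiable_imp_continuous_on[OF dF] by (intro continuous_intros) force+
    then have "((\<lambda>u. LBINT x=t0..u. 1 / F x) has_real_derivative 1 / F t) (at t within I)"
      using int t0 t by (intro has_real_derivative_interval_integral)
    then show ?thesis
      unfolding has_field_derivative_def
      by (rule has_derivative_transform[OF t \<tau>, rotated])
  qed
  interpret time_change I F \<tau>
    by unfold_locales (use int thick smooth_F F_pos d\<tau> in auto)
  let ?E = "\<lambda>t. ddir I (ddir I \<gamma> 1) 1 t + (ddir I F 1 t / F t) *\<^sub>R ddir I \<gamma> 1 t
      - ((d1 / (l1 t)\<^sup>2) *\<^sub>R fst (\<gamma> t), (d2 / (l2 t)\<^sup>2) *\<^sub>R snd (\<gamma> t))"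
  let ?N = "\<lambda>t. (F t)\<^sup>2 *\<^sub>R ddir I (ddir I \<gamma> 1) 1 t + (F t * ddir I F 1 t) *\<^sub>R ddir I \<gamma> 1 t
      - \<kappa> *\<^sub>R (0, snd (\<gamma> t))"
  have E_N: "sphere_proj (\<gamma> t) (?E t) = 0 \<longleftrightarrow> sphere_proj (\<gamma> t) (?N t) = 0" if t: "t \<in> I" for t
  proof -
    have F0: "F t \<noteq> 0" using F_pos[OF t] by simp
    have "d2 / (l2 t)\<^sup>2 = d1 / (l1 t)\<^sup>2 + \<kappa> / (F t)\<^sup>2"
      using T_eq[OF t] T[OF t] by simp
    then have "(F t)\<^sup>2 *\<^sub>R ?E t = ?N t - ((F t)\<^sup>2 * (d1 / (l1 t)\<^sup>2)) *\<^sub>R \<gamma> t"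
      using F0 by (cases "\<gamma> t") (simp add: prod_eq_iff algebra_simps power2_eq_square)
    then have "sphere_proj (\<gamma> t) ((F t)\<^sup>2 *\<^sub>R ?E t)
        = sphere_proj (\<gamma> t) (?N t - ((F t)\<^sup>2 * (d1 / (l1 t)\<^sup>2)) *\<^sub>R \<gamma> t)"
      by (rule arg_cong)
    then have "(F t)\<^sup>2 *\<^sub>R sphere_proj (\<gamma> t) (?E t)
        = sphere_proj (\<gamma> t) (?N t) - ((F t)\<^sup>2 * (d1 / (l1 t)\<^sup>2)) *\<^sub>R sphere_proj (\<gamma> t) (\<gamma> t)"
      by (simp only: linear_diff[OF linear_sphere_proj] linear_scale[OF linear_sphere_proj])
    moreover have "sphere_proj (\<gamma> t) (\<gamma> t) = 0"
      using \<gamma>(2) t by (intro sphere_proj_self) auto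
    ultimately have "(F t)\<^sup>2 *\<^sub>R sphere_proj (\<gamma> t) (?E t) = sphere_proj (\<gamma> t) (?N t)"
      by simp
    then show ?thesis
      using F0 by (metis (no_types, lifting) scaleR_eq_0_iff zero_eq_power2)
  qed
  have "harmonic_into_sphere (warped_product I l1 l2 M1 M2) (product_map \<gamma> f1 f2)
      \<longleftrightarrow> (\<forall>t\<in>I. sphere_proj (\<gamma> t) (?E t) = 0)"
    by (subst harmonic_product_map_iff[OF M thick l_pos(1) dl1 l_pos(2) dl2 \<gamma>])
      (simp_all add: log_deriv)
  also have "\<dots> \<longleftrightarrow> (\<forall>t\<in>I. sphere_proj (\<gamma> t) (?N t) = 0)"
    using E_N by blast
  also have "\<dots> \<longleftrightarrow> (\<exists>\<Gamma>. neumann_solution \<kappa> (\<tau> ` I) \<Gamma> \<and> (\<forall>t\<in>I. \<gamma> t = \<Gamma> (\<tau> t)))"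
  proof
    assume N: "\<forall>t\<in>I. sphere_proj (\<gamma> t) (?N t) = 0"
    \<comment> \<open>The witness is \<gamma> composed with the inverse time change
      \<open>\<sigma>\<close>.\<close>
    have eq: "\<gamma> t = (\<lambda>s. \<gamma> (\<sigma> s)) (\<tau> t)" if "t \<in> I" for t
      using \<sigma>_\<tau>[OF that] by simp
    show "\<exists>\<Gamma>. neumann_solution \<kappa> (\<tau> ` I) \<Gamma> \<and> (\<forall>t\<in>I. \<gamma> t = \<Gamma> (\<tau> t))"
      using iffD2[OF neumann_solution_iff[OF \<gamma> eq] N] eq by blast
  next
    assume "\<exists>\<Gamma>. neumann_solution \<kappa> (\<tau> ` I) \<Gamma> \<and> (\<forall>t\<in>I. \<gamma> t = \<Gamma> (\<tau> t))"
    then obtain \<Gamma> where \<Gamma>: "neumann_solution \<kappa> (\<tau> ` I) \<Gamma>" "\<And>t. t \<in> I \<Longrightarrow> \<gamma> t = \<Gamma> (\<tau> t)"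
      by blast
    show "\<forall>t\<in>I. sphere_proj (\<gamma> t) (?N t) = 0"
      by (rule iffD1[OF neumann_solution_iff[OF \<gamma> \<Gamma>(2)] \<Gamma>(1)])
  qed
  finally show ?thesis .
qed

end
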